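(* Let $N,P,p,n$ be strictly positive integers, let $(n_i)_{1\leq i\leq N}$ be strictly positive integers with $\sum_{i=1}^Nn_i=n$, and let $(p_i)_{1\leq i\leq P}$ be strictly positive integers. Let $\varsigma\in\Gamma_0(\mathbb R^N)$, $\varpi\in\Gamma_0(\mathbb R^P)$, $\theta\in\Gamma_0(\mathbb R^p)$. For every $i\in\{1,\dots,N\}$ let $\varphi_i\in\Gamma_0(\mathbb R^{n_i})$, $X_i\in\mathbb R^{n_i\times p}$, $y_i\in\mathbb R^{n_i}$; for every $i\in\{1,\dots,P\}$ let $\psi_i\in\Gamma_0(\mathbb R^{p_i})$, $L_i\in\mathbb R^{p_i\times p}$. Consider the problem $$\underset{s\in\mathbb R^N,\,t\in\mathbb R^P,\,b\in\mathbb R^p}{\text{minimize}}\;\;\varsigma(s)+\varpi(t)+\theta(b)+\sum_{i=1}^N\widetilde\varphi_i(\sigma_i,X_ib-y_i)+\sum_{i=1}^P\widetilde\psi_i(\tau_i,L_ib),\qquad(\ast)$$ where $s=(\sigma_i)_{1\leq i\leq N}$ and $t=(\tau_i)_{1\leq i\leq P}$. Suppose that $\boldsymbol V\cap\operatorname{ri}\operatorname{dom}\boldsymbol F\neq\varnothing$, with $\boldsymbol V$ and $\boldsymbol F$ as defined in the context. Set $m=n+\sum_{i=1}^Pp_i$, let $A\in\mathbb R^{m\times p}$ be the matrix obtained by stacking $X_1,\dots,X_N,L_1,\dots,L_P$ vertically, and set $Q=A^\top(\operatorname{Id}+AA^\top)^{-1}$. Let $\gamma\in\left]0,+\infty\right[$,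 let $(\mu_k)_{k\in\mathbb N}$ be a sequence in $\left]0,2\right[$ such that $\sum_{k\in\mathbb N}\mu_k(2-\mu_k)=+\infty$, and let $x_{s,0},h_{s,0}\in\mathbb R^N$, $x_{t,0},h_{t,0}\in\mathbb R^P$, $x_{b,0}\in\mathbb R^p$, $h_{b,0}\in\mathbb R^m$ be arbitrary. Write $h_{s,k}=(\eta_{i,k})_{1\leq i\leq N}$, $h_{t,k}=(\eta_{N+i,k})_{1\leq i\leq P}$, $s_k=(\sigma_{i,k})_{1\leq i\leq N}$, $t_k=(\tau_{i,k})_{1\leq i\leq P}$, $d_{s,k}=(\delta_{i,k})_{1\leq i\leq N}$, $d_{t,k}=(\delta_{N+i,k})_{1\leq i\leq P}$, and decompose the vectors $h_{b,k},c_{b,k},d_{b,k}\in\mathbb R^m$ into blocks $(h_{i,k})$, $(c_{i,k})$, $(d_{i,k})$, $1\leq i\leq N+P$, according to $\mathbb R^m=\mathbb R^{n_1}\times\cdots\times\mathbb R^{n_N}\times\mathbb R^{p_1}\times\cdots\times\mathbb R^{p_P}$. For $k=0,1,\dots$ iterate: $$\begin{aligned} &q_{s,k}=x_{s,k}-h_{s,k},\quad q_{t,k}=x_{t,k}-h_{t,k},\quad q_{b,k}=Ax_{b,k}-h_{b,k},\\ &s_k=x_{s,k}-q_{s,k}/2,\quad t_k=x_{t,k}-q_{t,k}/2,\quad b_k=x_{b,k}-Qq_{b,k},\\ &z_{s,k}=\operatorname{prox}_{\gamma\varsigma}(2s_k-x_{s,k}),\quad z_{t,k}=\operatorname{prox}_{\gamma\varpi}(2t_k-x_{t,k}),\quad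 z_{b,k}=\operatorname{prox}_{\gamma\theta}(2b_k-x_{b,k}),\\ &x_{s,k+1}=x_{s,k}+\mu_k(z_{s,k}-s_k),\quad x_{t,k+1}=x_{t,k}+\mu_k(z_{t,k}-t_k),\quad x_{b,k+1}=x_{b,k}+\mu_k(z_{b,k}-b_k),\\ &\text{for }i=1,\dots,N:\; c_{i,k}=X_ib_k,\;\;(\delta_{i,k},d_{i,k})=(0,y_i)+\operatorname{prox}_{\gamma\widetilde\varphi_i}(2\sigma_{i,k}-\eta_{i,k},\,2c_{i,k}-h_{i,k}-y_i),\\ &\text{for }i=1,\dots,P:\; c_{N+i,k}=L_ib_k,\;\;(\delta_{N+i,k},d_{N+i,k})=\operatorname{prox}_{\gamma\widetilde\psi_i}(2\tau_{i,k}-\eta_{N+i,k},\,2c_{N+i,k}-h_{N+i,k}),\\ &h_{s,k+1}=h_{s,k}+\mu_k(d_{s,k}-s_k),\quad h_{t,k+1}=h_{t,k}+\mu_k(d_{t,k}-t_k),\quad h_{b,k+1}=h_{b,k}+\mu_k(d_{b,k}-c_{b,k}). \end{aligned}$$ Then the sequences $(s_k)_{k\in\mathbb N}$, $(t_k)_{k\in\mathbb N}$, and $(b_k)_{k\in\mathbb N}$ converge to vectors $s$, $t$, and $b$, respectively, that solve $(\ast)$.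
   Context: $\Gamma_0(\mathbb R^d)$ is the class of proper lower semicontinuous convex functions from $\mathbb R^d$ to $\left]-\infty,+\infty\right]$. For $\varphi\in\Gamma_0(\mathbb R^d)$, the recession function is $(\operatorname{rec}\varphi)(x)=\sup_{y\in\operatorname{dom}\varphi}(\varphi(x+y)-\varphi(y))$, and the perspective $\widetilde\varphi\colon\mathbb R\times\mathbb R^d\to\left]-\infty,+\infty\right]$ is defined by $\widetilde\varphi(\sigma,x)=\sigma\varphi(x/\sigma)$ if $\sigma>0$, $\widetilde\varphi(0,x)=(\operatorname{rec}\varphi)(x)$, and $\widetilde\varphi(\sigma,x)=+\infty$ if $\sigma<0$; it is a proper lower semicontinuous convex function on $\mathbb R^{d+1}$. For $f\in\Gamma_0(\mathbb R^d)$, $\operatorname{prox}_f(z)$ is the unique minimizer over $y$ of $f(y)+\frac12\|z-y\|_2^2$. $\operatorname{ri}$ denotes relative interior, and $\operatorname{dom}$ is the set of points at which a function is $<+\infty$. Set $M=N+P$. For $v=(s,t)\in\mathbb R^N\times\mathbb R^P=\mathbb R^M$, $b\in\mathbb R^p$, and $z=(z_1,\dots,z_{N+P})\in\mathbb R^m=\mathbb R^{n_1}\times\cdots\times\mathbb R^{n_N}\times\mathbb R^{p_1}\times\cdots\times\mathbb R^{p_P}$, define $\boldsymbol f(v,b)=\varsigma(s)+\varpi(t)+\theta(b)$, $\boldsymbol g(v,z)=\sum_{i=1}^N\widetilde\varphi_i(\sigma_i,z_i-y_i)+\sum_{i=1}^P\widetilde\psi_i(\tau_i,z_{N+i})$,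 and $\boldsymbol L(v,b)=(v,Ab)$. Then $\boldsymbol F\colon\mathbb R^{M+p}\times\mathbb R^{M+m}\to\left]-\infty,+\infty\right]$ is $\boldsymbol F(\boldsymbol a,\boldsymbol c)=\boldsymbol f(\boldsymbol a)+\boldsymbol g(\boldsymbol c)$, and $\boldsymbol V=\{(\boldsymbol x,\boldsymbol h)\in\mathbb R^{M+p}\times\mathbb R^{M+m}\mid\boldsymbol L\boldsymbol x=\boldsymbol h\}$ is the graph of $\boldsymbol L$.
   Formalization: The formal theorem additionally assumes that problem (∗) has a solution; without this the claim fails, e.g. with all dimensions 1, θ = exp, all other functions, matrices and y₁ equal to 0, where the infimum 0 is not attained. *)

theory Defs
  imports "HOL-Analysis.Analysis"
begin

(* Functions from a linear subspace S of a Euclidean space to ]-infinity, +infinity] are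
   ereal-valued functions of which only the restriction to S matters.  The carrier S is needed
   because the dimensions of the blocks R^(n_i), R^(p_i) vary with the index i; see block_space. *)

definition dom_on :: "'a set \<Rightarrow> ('a \<Rightarrow> ereal) \<Rightarrow> 'a set" where
  "dom_on S f = {x \<in> S. f x < \<infinity>}"

definition proper_on :: "'a set \<Rightarrow> ('a \<Rightarrow> ereal) \<Rightarrow> bool" where
  "proper_on S f \<longleftrightarrow> (\<forall>x\<in>S. f x > -\<infinity>) \<and> dom_on S f \<noteq> {}"

definition lsc_on :: "'a::topological_space set \<Rightarrow> ('a \<Rightarrow> ereal) \<Rightarrow> bool" where
  "lsc_on S f \<longleftrightarrow> (\<forall>x\<in>S. f x \<le> Liminf (at x within S) f)"

definition ereal_convex_on :: "'a::real_vector set \<Rightarrow> ('a \<Rightarrow> ereal) \<Rightarrow> bool" where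
  "ereal_convex_on S f \<longleftrightarrow>
     (\<forall>x\<in>S. \<forall>y\<in>S. \<forall>\<alpha>\<in>{0<..<1}.
        f ((1 - \<alpha>) *\<^sub>R x + \<alpha> *\<^sub>R y) \<le> ereal (1 - \<alpha>) * f x + ereal \<alpha> * f y)"

definition Gamma0 :: "'a::euclidean_space set \<Rightarrow> ('a \<Rightarrow> ereal) set" where
  "Gamma0 S = {f. proper_on S f \<and> lsc_on S f \<and> ereal_convex_on S f}"

definition recession :: "'a::real_vector set \<Rightarrow> ('a \<Rightarrow> ereal) \<Rightarrow> 'a \<Rightarrow> ereal" where
  "recession S f x = (SUP y\<in>dom_on S f. f (x + y) - f y)"

definition perspective :: "'a::real_vector set \<Rightarrow> ('a \<Rightarrow> ereal) \<Rightarrow> real \<times> 'a \<Rightarrow> ereal" where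
  "perspective S f = (\<lambda>(\<sigma>, x).
     if \<sigma> > 0 then ereal \<sigma> * f (x /\<^sub>R \<sigma>)
     else if \<sigma> = 0 then recession S f x
     else \<infinity>)"

definition prox :: "'a::euclidean_space set \<Rightarrow> ('a \<Rightarrow> ereal) \<Rightarrow> 'a \<Rightarrow> 'a" where
  "prox S f z = (THE y. is_arg_min (\<lambda>y. f y + ereal ((norm (z - y))\<^sup>2 / 2)) (\<lambda>y. y \<in> S) y)"

(* A map \<beta> from the coordinates 'm of R^m to the N + P block indices encodes the decomposition
   R^m = R^(n_1) x ... x R^(n_N) x R^(p_1) x ... x R^(p_P).  Block r is the coordinate subspace
   spanned by the coordinates in the fibre of \<beta> over r. *)

definition block_space :: "('m::finite \<Rightarrow> 'r) \<Rightarrow> 'r \<Rightarrow> (real^'m) set" where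
  "block_space \<beta> r = {x. \<forall>j. \<beta> j \<noteq> r \<longrightarrow> x $ j = 0}"

definition block :: "('m::finite \<Rightarrow> 'r) \<Rightarrow> 'r \<Rightarrow> real^'m \<Rightarrow> real^'m" where
  "block \<beta> r z = (\<chi> j. if \<beta> j = r then z $ j else 0)"

(* A matrix with p columns and one row for each coordinate of block r: all other rows vanish. *)
definition block_matrices :: "('m::finite \<Rightarrow> 'r) \<Rightarrow> 'r \<Rightarrow> (real^'p^'m) set" where
  "block_matrices \<beta> r = {B. \<forall>j. \<beta> j \<noteq> r \<longrightarrow> row j B = 0}"

definition stack :: "('m::finite \<Rightarrow> 'N + 'P) \<Rightarrow> ('N \<Rightarrow> real^'p^'m) \<Rightarrow> ('P \<Rightarrow> real^'p^'m) \<Rightarrow> real^'p^'m"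
  where "stack \<beta> X L = (\<chi> j. case \<beta> j of Inl i \<Rightarrow> row j (X i) | Inr i \<Rightarrow> row j (L i))"

definition objective ::
  "('m::finite \<Rightarrow> 'N::finite + 'P::finite) \<Rightarrow> (real^'N \<Rightarrow> ereal) \<Rightarrow> (real^'P \<Rightarrow> ereal) \<Rightarrow> (real^'p \<Rightarrow> ereal)
   \<Rightarrow> ('N \<Rightarrow> real^'m \<Rightarrow> ereal) \<Rightarrow> ('N \<Rightarrow> real^'p^'m) \<Rightarrow> ('N \<Rightarrow> real^'m)
   \<Rightarrow> ('P \<Rightarrow> real^'m \<Rightarrow> ereal) \<Rightarrow> ('P \<Rightarrow> real^'p^'m)
   \<Rightarrow> (real^'N) \<times> (real^'P) \<times> (real^'p) \<Rightarrow> ereal" where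
  "objective \<beta> \<zeta> \<omega> \<theta> \<phi> X y \<psi> L = (\<lambda>(s, t, b).
     \<zeta> s + \<omega> t + \<theta> b
     + (\<Sum>i\<in>UNIV. perspective (block_space \<beta> (Inl i)) (\<phi> i) (s $ i, X i *v b - y i))
     + (\<Sum>i\<in>UNIV. perspective (block_space \<beta> (Inr i)) (\<psi> i) (t $ i, L i *v b)))"

(* The constraint qualification in terms of F below does not provide a minimizer of the
   objective: take \<theta> = exp on R and all other functions 0.  Existence of a minimizer is
   therefore a separate hypothesis of any result on convergence to one. *)
definition solves ::
  "('m::finite \<Rightarrow> 'N::finite + 'P::finite) \<Rightarrow> (real^'N \<Rightarrow> ereal) \<Rightarrow> (real^'P \<Rightarrow> ereal) \<Rightarrow> (real^'p \<Rightarrow> ereal)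
   \<Rightarrow> ('N \<Rightarrow> real^'m \<Rightarrow> ereal) \<Rightarrow> ('N \<Rightarrow> real^'p^'m) \<Rightarrow> ('N \<Rightarrow> real^'m)
   \<Rightarrow> ('P \<Rightarrow> real^'m \<Rightarrow> ereal) \<Rightarrow> ('P \<Rightarrow> real^'p^'m)
   \<Rightarrow> (real^'N) \<times> (real^'P) \<times> (real^'p) \<Rightarrow> bool" where
  "solves \<beta> \<zeta> \<omega> \<theta> \<phi> X y \<psi> L u \<longleftrightarrow>
     is_arg_min (objective \<beta> \<zeta> \<omega> \<theta> \<phi> X y \<psi> L) (\<lambda>_. True) u"

definition bold_f ::
  "(real^'N \<Rightarrow> ereal) \<Rightarrow> (real^'P \<Rightarrow> ereal) \<Rightarrow> (real^'p \<Rightarrow> ereal)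
   \<Rightarrow> ((real^'N) \<times> (real^'P)) \<times> (real^'p) \<Rightarrow> ereal" where
  "bold_f \<zeta> \<omega> \<theta> = (\<lambda>((s, t), b). \<zeta> s + \<omega> t + \<theta> b)"

definition bold_g ::
  "('m::finite \<Rightarrow> 'N::finite + 'P::finite) \<Rightarrow> ('N \<Rightarrow> real^'m \<Rightarrow> ereal) \<Rightarrow> ('N \<Rightarrow> real^'m)
   \<Rightarrow> ('P \<Rightarrow> real^'m \<Rightarrow> ereal) \<Rightarrow> ((real^'N) \<times> (real^'P)) \<times> (real^'m) \<Rightarrow> ereal" where
  "bold_g \<beta> \<phi> y \<psi> = (\<lambda>((s, t), z).
     (\<Sum>i\<in>UNIV. perspective (block_space \<beta> (Inl i)) (\<phi> i) (s $ i, block \<beta> (Inl i) z - y i))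
     + (\<Sum>i\<in>UNIV. perspective (block_space \<beta> (Inr i)) (\<psi> i) (t $ i, block \<beta> (Inr i) z)))"

definition bold_L :: "real^'p^'m \<Rightarrow> 'v \<times> (real^'p) \<Rightarrow> 'v \<times> (real^'m)" where
  "bold_L A = (\<lambda>(v, b). (v, A *v b))"

definition bold_F :: "('a \<Rightarrow> ereal) \<Rightarrow> ('c \<Rightarrow> ereal) \<Rightarrow> 'a \<times> 'c \<Rightarrow> ereal" where
  "bold_F f g = (\<lambda>(a, c). f a + g c)"

definition bold_V :: "('a \<Rightarrow> 'c) \<Rightarrow> ('a \<times> 'c) set" where
  "bold_V T = {(x, h). T x = h}"

end

theory Submission
  imports Defs
begin

text \<open>With \<open>w\<^sub>k = (x\<^sub>k, h\<^sub>k)\<close>, the algorithm is the relaxed Douglas--Rachford iteration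
  \<open>w\<^sub>k\<^sub>+\<^sub>1 = w\<^sub>k + \<mu>\<^sub>k (prox (2 p\<^sub>k - w\<^sub>k) - p\<^sub>k)\<close> for the minimization of \<open>F\<close> over the graph \<open>V\<close> of
  \<open>L\<close>, where \<open>p\<^sub>k = (s\<^sub>k, t\<^sub>k, b\<^sub>k, s\<^sub>k, t\<^sub>k, A b\<^sub>k)\<close> is the orthogonal projection of \<open>w\<^sub>k\<close> onto \<open>V\<close>, and the
  prox is that of \<open>\<gamma> F\<close>, which is separable. A minimizer of \<open>F\<close> over \<open>V\<close> has a subgradient
  orthogonal to \<open>V\<close> by the relative interior condition, and this pair gives a fixed point. The
  distance to every fixed point decreases along \<open>w\<^sub>k\<close>; as \<open>\<mu>\<^sub>k (2 - \<mu>\<^sub>k)\<close> is not summable, the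
  increments vanish along a subsequence, and a cluster point of that subsequence is a fixed point,
  to which the whole sequence must converge.

  Lower semicontinuity and convexity of the perspective of \<open>f\<close> come from writing it as the supremum
  of the functions \<open>(\<sigma>, x) \<mapsto> a \<bullet> x + k \<sigma>\<close> over the affine minorants \<open>a \<bullet> x + k\<close> of \<open>f\<close>; proximal points
  with parameter tending to 0 provide enough minorants.\<close>

subsection \<open>Lower semicontinuous convex functions\<close>

lemma lsc_onD_sequentially:
  assumes "lsc_on S f" "x \<in> S" "\<And>n. u n \<in> S" "u \<longlonglongrightarrow> x"
  shows "f x \<le> liminf (\<lambda>n. f (u n))"
  unfolding le_Liminf_iff
proof (intro allI impI)
  fix c assume c: "c < f x"
  have "f x \<le> Liminf (at x within S) f"
    using assms by (simp add: lsc_on_def)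
  then have "\<forall>\<^sub>F y in at x within S. c < f y"
    using c by (simp add: le_Liminf_iff)
  then obtain U where "open U" "x \<in> U" "\<And>y. y \<in> U \<Longrightarrow> y \<in> S \<Longrightarrow> y \<noteq> x \<Longrightarrow> c < f y"
    unfolding eventually_at_topological by blast
  \<comment> \<open>The filter \<open>at x within S\<close> leaves out \<open>x\<close> itself,
    whereas the sequence may visit \<open>x\<close>; there the bound is the assumption
    \<open>c < f x\<close>.\<close>
  then have U: "open U" "x \<in> U" "\<And>y. y \<in> U \<Longrightarrow> y \<in> S \<Longrightarrow> c < f y"
    using c by blast+
  have "\<forall>\<^sub>F n in sequentially. u n \<in> U"
    using topological_tendstoD assms(4) U by blast
  then show "\<forall>\<^sub>F n in sequentially. c < f (u n)"
    by eventually_elim (use U assms in auto)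
qed

lemma lsc_on_bounded_limit:
  assumes "lsc_on S f" "x \<in> S" "\<And>n. u n \<in> S" "u \<longlonglongrightarrow> x"
    and "\<And>n. f (u n) \<le> ereal (r n)" "r \<longlonglongrightarrow> l"
  shows "f x \<le> ereal l"
proof -
  have "f x \<le> liminf (\<lambda>n. f (u n))"
    by (rule lsc_onD_sequentially[OF assms(1-4)])
  also have "\<dots> \<le> liminf (\<lambda>n. ereal (r n))"
    by (rule Liminf_mono) (simp add: assms)
  also have "\<dots> = ereal l"
    by (rule lim_imp_Liminf) (use assms in auto)
  finally show ?thesis .
qed

lemma lsc_on_subset: "lsc_on S f \<Longrightarrow> T \<subseteq> S \<Longrightarrow> lsc_on T f"
  unfolding lsc_on_def le_Liminf_iff
  by (meson at_le filter_leD subsetD)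

lemma lsc_onI_eventually:
  assumes "\<And>x c. x \<in> S \<Longrightarrow> c < f x \<Longrightarrow> \<forall>\<^sub>F y in at x within S. c < f y"
  shows "lsc_on S f"
  using assms unfolding lsc_on_def le_Liminf_iff by blast

lemma lsc_on_add:
  assumes "lsc_on S f" "lsc_on S g" "\<And>x. x \<in> S \<Longrightarrow> f x > -\<infinity>" "\<And>x. x \<in> S \<Longrightarrow> g x > -\<infinity>"
  shows "lsc_on S (\<lambda>x. f x + g x)"
proof (rule lsc_onI_eventually)
  fix x c assume x: "x \<in> S" and c: "c < f x + g x"
  \<comment> \<open>It suffices to split \<open>c\<close> into levels strictly below
    \<open>f x\<close> and \<open>g x\<close>. If both values are finite, the gap
    \<open>p + q - r\<close> is shared equally; if one is infinite, it takes whatever the other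
    leaves.\<close>
  obtain a b where ab: "a < f x" "b < g x" "c \<le> a + b"
  proof (cases "c = -\<infinity>")
    case True
    then show ?thesis using that[of "-\<infinity>" "-\<infinity>"] assms x by auto
  next
    case False
    then obtain r where r: "c = ereal r" using c by (cases c) auto
    consider (fin) p q where "f x = ereal p" "g x = ereal q" | (f) "f x = \<infinity>" | (g) "g x = \<infinity>"
      using assms(3,4)[OF x] by (cases "f x"; cases "g x") auto
    then show ?thesis
    proof cases
      case fin
      then have "r < p + q" using c r by simp
      then show ?thesis
        using that[of "ereal (p - (p+q-r)/2)" "ereal (q - (p+q-r)/2)"] fin r by (simp add: field_simps)
    next
      case f
      obtain q where "ereal q < g x" using assms(4)[OF x] lt_ex by (metis ereal_dense2)
      then show ?thesis using that[of "ereal (r - q)" "ereal q"] f r by simp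
    next
      case g
      obtain q where "ereal q < f x" using assms(3)[OF x] by (metis ereal_dense2)
      then show ?thesis using that[of "ereal q" "ereal (r - q)"] g r by simp
    qed
  qed
  have "\<forall>\<^sub>F y in at x within S. a < f y" "\<forall>\<^sub>F y in at x within S. b < g y"
    using assms(1,2) x ab unfolding lsc_on_def le_Liminf_iff by blast+
  then show "\<forall>\<^sub>F y in at x within S. c < f y + g y"
    by eventually_elim (use ab ereal_add_strict_mono2 in \<open>meson order.strict_trans1\<close>)
qed

lemma lsc_on_continuous:
  fixes h :: "'a::t2_space \<Rightarrow> real"
  assumes "continuous_on S h"
  shows "lsc_on S (\<lambda>x. ereal (h x))"
proof (rule lsc_onI_eventually)
  fix x c assume "x \<in> S" "c < ereal (h x)"
  moreover have "((\<lambda>y. ereal (h y)) \<longlongrightarrow> ereal (h x)) (at x within S)"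
    using assms \<open>x \<in> S\<close> unfolding continuous_on_def by auto
  ultimately show "\<forall>\<^sub>F y in at x within S. c < ereal (h y)"
    using order_tendstoD(1) by blast
qed

text \<open>A minimizing sequence has a subsequence that converges in \<open>K\<close>, and
  semicontinuity bounds \<open>f\<close> at its limit by the infimum. This covers an infimum equal
  to minus infinity, which is then attained as well.\<close>

lemma lsc_on_compact_attains_inf:
  fixes f :: "'a::metric_space \<Rightarrow> ereal"
  assumes "compact K" "K \<noteq> {}" "lsc_on K f"
  obtains x where "x \<in> K" "\<And>y. y \<in> K \<Longrightarrow> f x \<le> f y"
proof -
  obtain v where v: "\<And>n. v n \<in> f ` K" "v \<longlonglongrightarrow> Inf (f ` K)"
    using Inf_as_limit[of "f ` K"] assms(2) by blast
  then obtain u where u: "\<And>n. u n \<in> K" "\<And>n. v n = f (u n)"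
    unfolding image_iff by metis
  obtain x r where xr: "x \<in> K" "strict_mono (r :: nat \<Rightarrow> nat)" "(u \<circ> r) \<longlonglongrightarrow> x"
    using assms(1) u(1) unfolding compact_def by blast
  have "f x \<le> liminf (\<lambda>n. f ((u \<circ> r) n))"
    by (rule lsc_onD_sequentially[OF assms(3) xr(1) _ xr(3)]) (simp add: u(1))
  also have "\<dots> = Inf (f ` K)"
  proof (rule lim_imp_Liminf)
    show "(\<lambda>n. f ((u \<circ> r) n)) \<longlonglongrightarrow> Inf (f ` K)"
      using LIMSEQ_subseq_LIMSEQ[OF v(2) xr(2)] u(2) by (simp add: o_def)
  qed simp
  finally have "f x \<le> f y" if "y \<in> K" for y
    using that by (meson INF_lower order_trans)
  with xr(1) show ?thesis using that by blast
qed

section \<open>The class \<open>Gamma0\<close>\<close>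

lemma Gamma0_notMInf: "f \<in> Gamma0 S \<Longrightarrow> x \<in> S \<Longrightarrow> f x > -\<infinity>"
  by (simp add: Gamma0_def proper_on_def)

lemma Gamma0_finite_point:
  assumes "f \<in> Gamma0 S"
  obtains x r where "x \<in> S" "f x = ereal r"
proof -
  obtain x where "x \<in> S" "f x < \<infinity>" "f x > -\<infinity>"
    using assms by (auto simp: Gamma0_def proper_on_def dom_on_def)
  then show ?thesis using that by (cases "f x") auto
qed

lemma Gamma0_convexD_real:
  assumes "f \<in> Gamma0 S" "x \<in> S" "y \<in> S" "f x = ereal a" "f y = ereal b" "0 < t" "t < 1"
  shows "f ((1 - t) *\<^sub>R x + t *\<^sub>R y) \<le> ereal ((1 - t) * a + t * b)"
proof -
  have "f ((1 - t) *\<^sub>R x + t *\<^sub>R y) \<le> ereal (1 - t) * f x + ereal t * f y"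
    using assms(1-3,6,7) unfolding Gamma0_def ereal_convex_on_def by simp
  then show ?thesis by (simp add: assms(4,5))
qed

lemma Gamma0_cmult:
  assumes "f \<in> Gamma0 S" "0 < c"
  shows "(\<lambda>x. ereal c * f x) \<in> Gamma0 S"
proof -
  have p: "proper_on S (\<lambda>x. ereal c * f x)"
    unfolding proper_on_def
  proof
    show "\<forall>x\<in>S. - \<infinity> < ereal c * f x"
    proof
      fix x assume "x \<in> S"
      then have "- \<infinity> < f x" by (rule Gamma0_notMInf[OF assms(1)])
      then show "- \<infinity> < ereal c * f x" using assms(2) by (cases "f x") auto
    qed
    obtain x r where "x \<in> S" "f x = ereal r" using Gamma0_finite_point[OF assms(1)] .
    then show "dom_on S (\<lambda>x. ereal c * f x) \<noteq> {}" by (auto simp: dom_on_def)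
  qed
  have "lsc_on S (\<lambda>x. ereal c * f x)"
  proof (rule lsc_onI_eventually)
    fix x e assume x: "x \<in> S" and e: "e < ereal c * f x"
    have iff: "e < ereal c * f y \<longleftrightarrow> e / ereal c < f y" for y
      using assms(2) by (cases e; cases "f y") (auto simp: field_simps)
    show "\<forall>\<^sub>F y in at x within S. e < ereal c * f y"
      using assms(1) x e unfolding iff Gamma0_def lsc_on_def le_Liminf_iff by blast
  qed
  moreover have "ereal_convex_on S (\<lambda>x. ereal c * f x)"
    unfolding ereal_convex_on_def
  proof (intro ballI)
    fix x y t assume *: "x \<in> S" "y \<in> S" "t \<in> {0<..<1::real}"
    have "f ((1 - t) *\<^sub>R x + t *\<^sub>R y) \<le> ereal (1 - t) * f x + ereal t * f y"
      using assms * unfolding Gamma0_def ereal_convex_on_def by blast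
    then have "ereal c * f ((1 - t) *\<^sub>R x + t *\<^sub>R y) \<le> ereal c * (ereal (1 - t) * f x + ereal t * f y)"
      using assms(2) by (intro ereal_mult_left_mono) auto
    also have "\<dots> = ereal (1 - t) * (ereal c * f x) + ereal t * (ereal c * f y)"
      using * assms(2) Gamma0_notMInf[OF assms(1), of x] Gamma0_notMInf[OF assms(1), of y]
      by (cases "f x"; cases "f y") (auto simp: field_simps)
    finally show "ereal c * f ((1 - t) *\<^sub>R x + t *\<^sub>R y)
        \<le> ereal (1 - t) * (ereal c * f x) + ereal t * (ereal c * f y)" .
  qed
  ultimately show ?thesis using p by (simp add: Gamma0_def)
qed

subsection \<open>Proximity operators and affine minorants\<close>

text \<open>By compactness \<open>f\<close> has a finite minimum \<open>m\<close> on the part of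
  \<open>S\<close> within distance 1 of a point \<open>x0\<close> of its domain. For
  \<open>y\<close> farther away, the segment from \<open>x0\<close> to \<open>y\<close> crosses the
  unit sphere where \<open>f\<close> is at least \<open>m\<close>, and convexity turns this into a
  linear bound at \<open>y\<close>. This crude bound comes before affine minorants and is used to
  construct them.\<close>

lemma Gamma0_lower_bound:
  fixes z :: "'a::euclidean_space"
  assumes f: "f \<in> Gamma0 S" and S: "closed S" "convex S"
  obtains C where "0 \<le> C" "\<And>y. y \<in> S \<Longrightarrow> ereal (- C * (1 + norm (y - z))) \<le> f y"
proof -
  obtain x0 f0 where x0: "x0 \<in> S" "f x0 = ereal f0"
    using Gamma0_finite_point[OF f] .
  let ?K = "S \<inter> cball x0 1"
  have "lsc_on ?K f"
    using f lsc_on_subset unfolding Gamma0_def by blast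
  moreover have "compact ?K" "?K \<noteq> {}" using S x0 by (auto intro: closed_Int_compact)
  ultimately obtain x1 where x1: "x1 \<in> ?K" "\<And>y. y \<in> ?K \<Longrightarrow> f x1 \<le> f y"
    using lsc_on_compact_attains_inf by metis
  have "f x1 \<le> ereal f0" using x1(2)[of x0] x0 by simp
  moreover have "f x1 > -\<infinity>" using Gamma0_notMInf[OF f] x1 by blast
  ultimately obtain m where m: "f x1 = ereal m" by (cases "f x1") auto
  \<comment> \<open>The factor \<open>1 + norm (z - x0)\<close> pays for moving the centre of the
    bound from \<open>x0\<close> to \<open>z\<close>.\<close>
  define C where "C = (\<bar>m\<bar> + \<bar>f0\<bar>) * (1 + norm (z - x0))"
  have C: "0 \<le> C" by (simp add: C_def)
  have bound: "ereal (- (\<bar>m\<bar> + \<bar>f0\<bar>) * (1 + norm (y - x0))) \<le> f y" if y: "y \<in> S" for y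
  proof (cases "norm (y - x0) \<le> 1")
    case True
    then have "ereal m \<le> f y" using x1(2)[of y] y m by (simp add: dist_norm norm_minus_commute)
    moreover have "- (\<bar>m\<bar> + \<bar>f0\<bar>) * (1 + norm (y - x0)) \<le> m"
    proof -
      have "0 \<le> \<bar>m\<bar> * norm (y - x0)" "0 \<le> \<bar>f0\<bar> * norm (y - x0)" by auto
      then show ?thesis unfolding distrib_left distrib_right minus_add_distrib mult_minus_left by linarith
    qed
    ultimately show ?thesis by (meson ereal_less_eq(3) order_trans)
  next
    case False
    define d where "d = norm (y - x0)"
    have d: "d > 1" using False by (simp add: d_def)
    show ?thesis
    proof (cases "f y")
      case (real r)
      \<comment> \<open>The point of the segment at distance exactly 1 from
        \<open>x0\<close>.\<close>
      let ?u = "(1 - 1/d) *\<^sub>R x0 + (1/d) *\<^sub>R y"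
      have u: "?u = x0 + (1/d) *\<^sub>R (y - x0)" by (simp add: algebra_simps)
      have "norm ((1/d) *\<^sub>R (y - x0)) = 1" using d by (simp flip: d_def)
      then have "?u \<in> cball x0 1" unfolding u by (simp add: dist_norm)
      moreover have "?u \<in> S"
        using S(2) x0(1) y d unfolding convex_alt by simp
      ultimately have "ereal m \<le> f ?u" using x1(2) m by simp
      also have "\<dots> \<le> ereal ((1 - 1/d) * f0 + 1/d * r)"
        by (rule Gamma0_convexD_real[OF f x0(1) y x0(2) real]) (use d in auto)
      finally have "d * m \<le> d * ((1 - 1/d) * f0 + 1/d * r)" using d by simp
      also have "\<dots> = (d - 1) * f0 + r" using d by (simp add: field_simps)
      finally have "d * m - (d - 1) * f0 \<le> r" by simp
      moreover have "d * m \<ge> - d * \<bar>m\<bar>" "(d - 1) * f0 \<le> d * \<bar>f0\<bar>"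
        using d mult_left_mono[of "-\<bar>m\<bar>" m d] mult_mono[of "d - 1" d f0 "\<bar>f0\<bar>"]
          mult_left_mono[of f0 "\<bar>f0\<bar>" "d - 1"] mult_right_mono[of "d - 1" d "\<bar>f0\<bar>"]
        by linarith+
      ultimately have "- (\<bar>m\<bar> + \<bar>f0\<bar>) * (1 + d) \<le> r" by (simp add: algebra_simps)
      then show ?thesis using real d_def by simp
    next
      case MInf
      then show ?thesis using Gamma0_notMInf[OF f y] by simp
    qed simp
  qed
  show ?thesis
  proof (rule that[OF C])
    fix y assume y: "y \<in> S"
    have "1 + norm (y - x0) \<le> 1 + norm (y - z) + norm (z - x0)"
      using norm_triangle_ineq[of "y - z" "z - x0"] by simp
    also have "\<dots> \<le> (1 + norm (z - x0)) * (1 + norm (y - z))" by (simp add: algebra_simps)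
    finally have "(\<bar>m\<bar> + \<bar>f0\<bar>) * (1 + norm (y - x0)) \<le> C * (1 + norm (y - z))"
      unfolding C_def mult.assoc by (intro mult_left_mono) auto
    then have "ereal (- C * (1 + norm (y - z))) \<le> ereal (- (\<bar>m\<bar> + \<bar>f0\<bar>) * (1 + norm (y - x0)))"
      by (simp add: algebra_simps)
    also have "\<dots> \<le> f y" by (rule bound[OF y])
    finally show "ereal (- C * (1 + norm (y - z))) \<le> f y" .
  qed
qed

text \<open>The quadratic term beats the linear decay allowed by \<open>Gamma0_lower_bound\<close>,
  so that minimization over \<open>S\<close> reduces to a compact piece of it.\<close>

lemma Gamma0_prox_attained:
  fixes z :: "'a::euclidean_space"
  assumes f: "f \<in> Gamma0 S" and S: "closed S" "convex S"
  obtains p where "p \<in> S"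
    "\<And>y. y \<in> S \<Longrightarrow> f p + ereal ((norm (z - p))\<^sup>2 / 2) \<le> f y + ereal ((norm (z - y))\<^sup>2 / 2)"
proof -
  define g where "g y = f y + ereal ((norm (z - y))\<^sup>2 / 2)" for y
  obtain C where C: "0 \<le> C" "\<And>y. y \<in> S \<Longrightarrow> ereal (- C * (1 + norm (y - z))) \<le> f y"
    using Gamma0_lower_bound[OF f S, where z = z] by blast
  obtain x0 f0 where x0: "x0 \<in> S" "f x0 = ereal f0"
    using Gamma0_finite_point[OF f] .
  define g0 where "g0 = f0 + (norm (z - x0))\<^sup>2 / 2"
  have g0: "g x0 = ereal g0" by (simp add: g_def g0_def x0)
  \<comment> \<open>At distance \<open>t > R\<close> from \<open>z\<close>, half the square of
    \<open>t\<close> exceeds \<open>C * (1 + t)\<close> by at least \<open>g0\<close>, so nothing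
    there beats \<open>x0\<close>. The summand \<open>norm (z - x0)\<close> keeps \<open>x0\<close>
    inside the ball.\<close>
  define R where "R = 2 * (C + \<bar>g0\<bar> + 1) + norm (z - x0)"
  let ?K = "S \<inter> cball z R"
  have "lsc_on S g"
    unfolding g_def
  proof (rule lsc_on_add)
    show "lsc_on S (\<lambda>y. ereal ((norm (z - y))\<^sup>2 / 2))"
      by (intro lsc_on_continuous continuous_intros) auto
  qed (use f Gamma0_notMInf[OF f] in \<open>auto simp: Gamma0_def\<close>)
  then have "lsc_on ?K g" by (rule lsc_on_subset) auto
  moreover have "compact ?K" using S by (auto intro: closed_Int_compact)
  moreover have x0K: "x0 \<in> ?K" using x0 C(1) by (simp add: R_def dist_norm)
  ultimately obtain p where p: "p \<in> ?K" "\<And>y. y \<in> ?K \<Longrightarrow> g p \<le> g y"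
    using lsc_on_compact_attains_inf by (metis empty_iff)
  have "g p \<le> g y" if y: "y \<in> S" for y
  proof (cases "y \<in> ?K")
    case False
    define t where "t = norm (y - z)"
    have t: "t > R" using False y by (simp add: t_def dist_norm norm_minus_commute)
    then have t2: "t \<ge> 2 * (C + \<bar>g0\<bar> + 1)" by (simp add: R_def) (smt (verit) norm_ge_zero)
    have t1: "t \<ge> 1" using t2 C(1) abs_ge_zero[of g0] unfolding distrib_left by linarith
    have "t * (2 * (C + \<bar>g0\<bar> + 1)) \<le> t * t" using t2 t1 by (intro mult_left_mono) auto
    then have "t\<^sup>2 / 2 \<ge> C * t + \<bar>g0\<bar> * t + t" by (simp add: power2_eq_square algebra_simps)
    moreover have "\<bar>g0\<bar> * t \<ge> \<bar>g0\<bar>" using t1 by (simp add: mult_le_cancel_left1)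
    moreover have "t \<ge> C" using t2 C(1) abs_ge_zero[of g0] unfolding distrib_left by linarith
    ultimately have "g0 \<le> - C * (1 + t) + t\<^sup>2 / 2" by (simp add: algebra_simps)
    then have "ereal g0 \<le> ereal (- C * (1 + t)) + ereal (t\<^sup>2/2)" by simp
    also have "\<dots> \<le> g y"
      unfolding g_def using C(2)[OF y] by (intro add_mono) (auto simp: t_def norm_minus_commute)
    finally show ?thesis using p(2)[OF x0K] g0 by simp
  qed (use p in auto)
  then show ?thesis using that p(1) unfolding g_def by blast
qed

text \<open>Minimality of \<open>p\<close> is tested at the points \<open>(1 - t) p + t y\<close>;
  dividing by \<open>t\<close> and letting \<open>t\<close> tend to 0 removes the quadratic
  remainder. The outcome is that \<open>z - p\<close> is a subgradient of \<open>f\<close> at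
  \<open>p\<close> relative to \<open>S\<close>.\<close>

lemma prox_variational_inequality:
  fixes z :: "'a::euclidean_space"
  assumes f: "f \<in> Gamma0 S" and "convex S" and p: "p \<in> S"
    and min: "\<forall>y\<in>S. f p + ereal ((norm (z - p))\<^sup>2 / 2) \<le> f y + ereal ((norm (z - y))\<^sup>2 / 2)"
  shows "\<bar>f p\<bar> \<noteq> \<infinity>" "\<And>y. y \<in> S \<Longrightarrow> f p + ereal ((z - p) \<bullet> (y - p)) \<le> f y"
proof -
  obtain x0 f0 where x0: "x0 \<in> S" "f x0 = ereal f0"
    using Gamma0_finite_point[OF f] .
  have "f p < \<infinity>" using bspec[OF min x0(1)] x0(2) by (cases "f p") auto
  then show fin: "\<bar>f p\<bar> \<noteq> \<infinity>" using Gamma0_notMInf[OF f p] by (cases "f p") auto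
  then obtain a where a: "f p = ereal a" by auto
  fix y assume y: "y \<in> S"
  show "f p + ereal ((z - p) \<bullet> (y - p)) \<le> f y"
  proof (cases "f y")
    case (real b)
    have step: "a + (z - p) \<bullet> (y - p) - b \<le> t * ((y - p) \<bullet> (y - p) / 2)" if t: "0 < t" "t < 1" for t
    proof -
      let ?u = "(1 - t) *\<^sub>R p + t *\<^sub>R y"
      have u: "?u \<in> S" using assms(2) p y t unfolding convex_alt by auto
      have e: "(norm (z - ?u))\<^sup>2
          = (norm (z - p))\<^sup>2 - 2 * t * ((z - p) \<bullet> (y - p)) + t * t * ((y - p) \<bullet> (y - p))"
      proof -
        have "z - ?u = (z - p) - t *\<^sub>R (y - p)" by (simp add: algebra_simps)
        then show ?thesis
          by (simp only: power2_norm_eq_inner inner_diff_left[of "z - p"] inner_diff_right[of _ "z - p"]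
              inner_scaleR_left inner_scaleR_right inner_commute[of "y - p" "z - p"])
            (simp add: algebra_simps)
      qed
      have "ereal (a + (norm (z - p))\<^sup>2 / 2) \<le> f ?u + ereal ((norm (z - ?u))\<^sup>2 / 2)"
        using bspec[OF min u] a by simp
      also have "\<dots> \<le> ereal ((1 - t) * a + t * b) + ereal ((norm (z - ?u))\<^sup>2 / 2)"
        by (intro add_mono Gamma0_convexD_real[OF f p y a real t]) auto
      finally have "a + (norm (z - p))\<^sup>2 / 2 \<le> (1 - t) * a + t * b + (norm (z - ?u))\<^sup>2 / 2" by simp
      then have "t * (a + (z - p) \<bullet> (y - p) - b) \<le> t * (t * ((y - p) \<bullet> (y - p) / 2))"
        unfolding e
        by (simp only: ring_distribs add_divide_distrib diff_divide_distrib mult.assoc times_divide_eq_right)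
      then show ?thesis using t by simp
    qed
    have "((\<lambda>t. t * ((y - p) \<bullet> (y - p) / 2)) \<longlongrightarrow> 0 * ((y - p) \<bullet> (y - p) / 2)) (at_right 0)"
      by (intro tendsto_intros)
    moreover have "\<forall>\<^sub>F t in at_right 0. a + (z - p) \<bullet> (y - p) - b \<le> t * ((y - p) \<bullet> (y - p) / 2)"
      using step by (auto simp: eventually_at_right_field intro!: exI[of _ 1])
    ultimately have "a + (z - p) \<bullet> (y - p) - b \<le> 0"
      using tendsto_lowerbound by fastforce
    then show ?thesis using a real by simp
  next
    case MInf
    then show ?thesis using Gamma0_notMInf[OF f y] by simp
  qed simp
qed

text \<open>Since \<open>prox\<close> is a definite description, it can be used only after existence
  and uniqueness of the minimizer are known. Uniqueness comes from the variational inequalities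
  themselves.\<close>

lemma prox_subgradient:
  fixes z :: "'a::euclidean_space"
  assumes f: "f \<in> Gamma0 S" and S: "closed S" "convex S"
  shows "prox S f z \<in> S" "\<bar>f (prox S f z)\<bar> \<noteq> \<infinity>"
    "\<And>y. y \<in> S \<Longrightarrow> f (prox S f z) + ereal ((z - prox S f z) \<bullet> (y - prox S f z)) \<le> f y"
proof -
  let ?g = "\<lambda>y. f y + ereal ((norm (z - y))\<^sup>2 / 2)"
  have arg: "is_arg_min ?g (\<lambda>y. y \<in> S) p \<longleftrightarrow> p \<in> S \<and> (\<forall>y\<in>S. ?g p \<le> ?g y)" for p
    unfolding is_arg_min_def by (meson linorder_not_less)
  have "\<exists>!p. is_arg_min ?g (\<lambda>y. y \<in> S) p"
  proof (rule ex_ex1I)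
    show "\<exists>p. is_arg_min ?g (\<lambda>y. y \<in> S) p"
      unfolding arg using Gamma0_prox_attained[OF f S, of z] by metis
  next
    fix p q assume "is_arg_min ?g (\<lambda>y. y \<in> S) p" "is_arg_min ?g (\<lambda>y. y \<in> S) q"
    then have p: "p \<in> S" "\<forall>y\<in>S. ?g p \<le> ?g y"
      and q: "q \<in> S" "\<forall>y\<in>S. ?g q \<le> ?g y" unfolding arg by auto
    note vp = prox_variational_inequality[OF f S(2) p]
    note vq = prox_variational_inequality[OF f S(2) q]
    obtain a b where "f p = ereal a" "f q = ereal b" using vp(1) vq(1) by auto
    \<comment> \<open>The function values cancel when the two inequalities are added.\<close>
    then have "(z - p) \<bullet> (q - p) + (z - q) \<bullet> (p - q) \<le> 0"
      using vp(2)[OF q(1)] vq(2)[OF p(1)] by simp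
    then have "(q - p) \<bullet> (q - p) \<le> 0" by (simp add: algebra_simps inner_commute)
    then show "p = q" using inner_gt_zero_iff[of "q - p"] by fastforce
  qed
  then have "is_arg_min ?g (\<lambda>y. y \<in> S) (prox S f z)"
    unfolding prox_def by (rule theI')
  then have p: "prox S f z \<in> S" "\<forall>y\<in>S. ?g (prox S f z) \<le> ?g y" unfolding arg by auto
  show "prox S f z \<in> S" by (rule p)
  show "\<bar>f (prox S f z)\<bar> \<noteq> \<infinity>"
    "\<And>y. y \<in> S \<Longrightarrow> f (prox S f z) + ereal ((z - prox S f z) \<bullet> (y - prox S f z)) \<le> f y"
    using prox_variational_inequality[OF f S(2) p] by auto
qed

text \<open>Dividing the inequality for \<open>c\<close> times \<open>f\<close> by \<open>c\<close>
  shows that \<open>(z - p) / c\<close> is a subgradient of \<open>f\<close> at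
  \<open>p\<close>.\<close>

lemma prox_cmult_subgradient:
  fixes z :: "'a::euclidean_space"
  assumes f: "f \<in> Gamma0 S" and S: "closed S" "convex S" and c: "0 < c"
    and p: "p = prox S (\<lambda>u. ereal c * f u) z"
  shows "p \<in> S" "\<bar>f p\<bar> \<noteq> \<infinity>" "\<And>y. y \<in> S \<Longrightarrow> f p + ereal ((z - p) \<bullet> (y - p) / c) \<le> f y"
proof -
  note * = prox_subgradient[OF Gamma0_cmult[OF f c] S, where z = z, folded p]
  show "p \<in> S" "\<bar>f p\<bar> \<noteq> \<infinity>" using * c by auto
  then obtain a where a: "f p = ereal a" by auto
  fix y assume y: "y \<in> S"
  show "f p + ereal ((z - p) \<bullet> (y - p) / c) \<le> f y"
  proof (cases "f y")
    case (real b)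
    then show ?thesis using *(3)[OF y] a c by (simp add: field_simps)
  qed (use Gamma0_notMInf[OF f y] in auto)
qed

text \<open>The subgradient at the proximal point \<open>p n\<close> of \<open>x\<close> with
  parameter \<open>l n\<close> gives a minorant that touches \<open>f\<close> at \<open>p n\<close>
  and whose value at \<open>x\<close> is \<open>f (p n)\<close> plus the squared distance from
  \<open>p n\<close> to \<open>x\<close> divided by \<open>l n\<close>. If none of these values
  exceeded \<open>c\<close>, then \<open>f (p n)\<close> would stay below \<open>c\<close> while
  \<open>p n\<close> tends to \<open>x\<close>, so semicontinuity would give
  \<open>f x \<le> c\<close>.\<close>

lemma Gamma0_affine_minorant:
  fixes x :: "'a::euclidean_space"
  assumes f: "f \<in> Gamma0 S" and S: "closed S" "convex S" and x: "x \<in> S" and c: "ereal c < f x"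
  obtains a k where "\<And>y. y \<in> S \<Longrightarrow> ereal (a \<bullet> y + k) \<le> f y" "c < a \<bullet> x + k"
proof (rule ccontr)
  assume no: "\<not> thesis"
  obtain C where C: "0 \<le> C" "\<And>y. y \<in> S \<Longrightarrow> ereal (- C * (1 + norm (y - x))) \<le> f y"
    using Gamma0_lower_bound[OF f S, where z = x] by blast
  define l where "l n = inverse (real (Suc n))" for n
  have l: "0 < l n" "l n \<le> 1" for n by (auto simp: l_def field_simps)
  have l0: "l \<longlonglongrightarrow> 0" unfolding l_def by (rule LIMSEQ_inverse_real_of_nat)
  define p where "p n = prox S (\<lambda>u. ereal (l n) * f u) x" for n
  note P = prox_cmult_subgradient[OF f S l(1) p_def]
  define d where "d n = norm (p n - x)" for n
  have key: "f (p n) \<le> ereal c" "(d n)\<^sup>2 \<le> l n * (2 * (c + C) + C\<^sup>2)" for n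
  proof -
    obtain r where r: "f (p n) = ereal r" using P(2) by blast
    have "ereal (((x - p n) /\<^sub>R l n) \<bullet> y + (r - ((x - p n) /\<^sub>R l n) \<bullet> p n)) \<le> f y" if "y \<in> S" for y
      using P(3)[OF that, of n] r by (simp add: inner_diff_right divide_inverse algebra_simps)
    then have "((x - p n) /\<^sub>R l n) \<bullet> x + (r - ((x - p n) /\<^sub>R l n) \<bullet> p n) \<le> c"
      using no that by (meson not_le)
    then have b: "r + (d n)\<^sup>2 / l n \<le> c"
      by (simp add: d_def norm_minus_commute[of "p n"] power2_norm_eq_inner inner_diff_right
          divide_inverse algebra_simps)
    have "(d n)\<^sup>2 / l n \<ge> 0" using l(1)[of n] by simp
    then show "f (p n) \<le> ereal c" using b r by simp
    have "- C * (1 + d n) \<le> r" using C(2)[OF P(1), of n] r by (simp add: d_def)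
    then have "(d n)\<^sup>2 / l n \<le> c + C * (1 + d n)" using b by simp
    then have *: "(d n)\<^sup>2 \<le> l n * (c + C) + l n * C * d n"
      using l(1)[of n] by (simp add: divide_simps algebra_simps)
    \<comment> \<open>Young's inequality absorbs the term linear in \<open>d n\<close> into the
      square on the left.\<close>
    have "0 \<le> (d n - l n * C)\<^sup>2" by simp
    then have "2 * (l n * C * d n) \<le> (d n)\<^sup>2 + (l n * C)\<^sup>2" by (simp add: power2_diff algebra_simps)
    moreover have "(l n * C)\<^sup>2 \<le> l n * C\<^sup>2"
      unfolding power_mult_distrib
      by (intro mult_right_mono) (use l[of n] in \<open>auto simp: power2_eq_square mult_left_le\<close>)
    ultimately show "(d n)\<^sup>2 \<le> l n * (2 * (c + C) + C\<^sup>2)" using * by (simp add: algebra_simps)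
  qed
  have "(\<lambda>n. l n * (2 * (c + C) + C\<^sup>2)) \<longlonglongrightarrow> 0 * (2 * (c + C) + C\<^sup>2)"
    by (intro tendsto_intros l0)
  then have lim: "(\<lambda>n. l n * (2 * (c + C) + C\<^sup>2)) \<longlonglongrightarrow> 0" by (simp only: mult_zero_left)
  have ev: "\<forall>\<^sub>F n in sequentially. (d n)\<^sup>2 \<le> l n * (2 * (c + C) + C\<^sup>2)"
    by (intro always_eventually allI key(2))
  have "(\<lambda>n. (d n)\<^sup>2) \<longlonglongrightarrow> 0"
    by (rule tendsto_sandwich[OF always_eventually ev tendsto_const lim]) simp
  then have "(\<lambda>n. sqrt ((d n)\<^sup>2)) \<longlonglongrightarrow> sqrt 0" by (intro tendsto_intros)
  then have "d \<longlonglongrightarrow> 0" by (simp add: d_def[abs_def])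
  then have "(\<lambda>n. norm (p n - x)) \<longlonglongrightarrow> 0" by (simp flip: d_def)
  then have "p \<longlonglongrightarrow> x" by (rule LIM_zero_cancel[OF tendsto_norm_zero_cancel])
  then have "f x \<le> ereal c"
    using lsc_on_bounded_limit[of S f x p "\<lambda>_. c" c] f x P(1) key(1) by (auto simp: Gamma0_def)
  then show False using c by simp
qed

subsection \<open>The perspective function\<close>

text \<open>Up to the sign of \<open>k\<close>, this is the epigraph of the conjugate of
  \<open>f\<close> taken over \<open>S\<close>.\<close>

definition affine_minorants :: "'a::euclidean_space set \<Rightarrow> ('a \<Rightarrow> ereal) \<Rightarrow> ('a \<times> real) set" where
  "affine_minorants S f = {(a, k). \<forall>y\<in>S. ereal (a \<bullet> y + k) \<le> f y}"

text \<open>Along the ray \<open>y0 + n x\<close> the function grows by at most \<open>r\<close>,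
  the value of the recession function at \<open>x\<close>, in each step, while the minorant grows by
  exactly \<open>a \<bullet> x\<close>. For large \<open>n\<close> the minorant would overtake
  \<open>f\<close> if \<open>a \<bullet> x > r\<close>.\<close>

lemma recession_ge_minorant:
  assumes f: "f \<in> Gamma0 S" and S: "subspace S" and x: "x \<in> S"
    and ak: "(a, k) \<in> affine_minorants S f"
  shows "ereal (a \<bullet> x) \<le> recession S f x"
proof (cases "recession S f x = \<infinity>")
  case False
  have step: "f (x + y) - f y \<le> recession S f x" if "y \<in> S" "f y < \<infinity>" for y
    unfolding recession_def using that by (intro SUP_upper) (simp add: dom_on_def)
  obtain y0 f0 where y0: "y0 \<in> S" "f y0 = ereal f0"
    using Gamma0_finite_point[OF f] .
  have "f (x + y0) > -\<infinity>" using Gamma0_notMInf[OF f] subspace_add[OF S x y0(1)] by blast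
  then have "f (x + y0) - f y0 > -\<infinity>" using y0 by (cases "f (x + y0)") auto
  then have "recession S f x > -\<infinity>" using step[of y0] y0 by auto
  then obtain r where r: "recession S f x = ereal r" using False by (cases "recession S f x") auto
  have iter: "y0 + real n *\<^sub>R x \<in> S \<and> f (y0 + real n *\<^sub>R x) \<le> ereal (f0 + n * r)" for n
  proof (induction n)
    case (Suc n)
    let ?y = "y0 + real n *\<^sub>R x"
    have e: "y0 + real (Suc n) *\<^sub>R x = x + ?y" by (simp add: algebra_simps)
    have "f ?y < \<infinity>" using Suc by (cases "f ?y") auto
    then have "f (x + ?y) - f ?y \<le> ereal r" using step[of ?y] Suc r by simp
    moreover obtain v where v: "f ?y = ereal v" "v \<le> f0 + n * r"
      using Suc Gamma0_notMInf[OF f, of ?y] by (cases "f ?y") auto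
    ultimately have "f (x + ?y) \<le> ereal (f0 + Suc n * r)"
      by (cases "f (x + ?y)") (auto simp: algebra_simps)
    then show ?case using Suc S x by (simp add: e subspace_add del: of_nat_Suc)
  qed (use y0 in auto)
  have "a \<bullet> y0 + k - f0 \<le> n * (r - a \<bullet> x)" for n :: nat
  proof -
    have "ereal (a \<bullet> (y0 + real n *\<^sub>R x) + k) \<le> f (y0 + real n *\<^sub>R x)"
      using ak iter[of n] by (auto simp: affine_minorants_def)
    also have "\<dots> \<le> ereal (f0 + n * r)" using iter[of n] by blast
    finally show ?thesis by (simp add: inner_add_right algebra_simps)
  qed
  note bound = this
  have "0 \<le> r - a \<bullet> x"
  proof (rule ccontr)
    assume "\<not> ?thesis"
    then obtain n :: nat where "f0 - (a \<bullet> y0 + k) < n * (a \<bullet> x - r)"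
      using reals_Archimedean3[of "a \<bullet> x - r"] by auto
    then show False using bound[of n] by (simp add: algebra_simps)
  qed
  then show ?thesis using r by simp
qed simp

lemma Gamma0_eq_SUP_minorants:
  assumes f: "f \<in> Gamma0 S" and S: "closed S" "convex S" and x: "x \<in> S"
  shows "f x = (SUP (a, k)\<in>affine_minorants S f. ereal (a \<bullet> x + k))"
proof (rule antisym)
  show "f x \<le> (SUP (a, k)\<in>affine_minorants S f. ereal (a \<bullet> x + k))"
  proof (rule ccontr)
    assume "\<not> ?thesis"
    then obtain c where c: "(SUP (a, k)\<in>affine_minorants S f. ereal (a \<bullet> x + k)) < ereal c" "ereal c < f x"
      by (meson ereal_dense2 linorder_not_less)
    obtain a k where "\<And>y. y \<in> S \<Longrightarrow> ereal (a \<bullet> y + k) \<le> f y" "c < a \<bullet> x + k"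
      using Gamma0_affine_minorant[OF f S x c(2)] by blast
    then have "(a, k) \<in> affine_minorants S f" by (simp add: affine_minorants_def)
    then have "ereal (a \<bullet> x + k) \<le> (SUP (a, k)\<in>affine_minorants S f. ereal (a \<bullet> x + k))"
      by (intro SUP_upper2[of "(a, k)"]) auto
    then show False using c(1) \<open>c < a \<bullet> x + k\<close> by (meson ereal_less_eq(3) leD le_less_trans less_ereal.simps(1) less_trans)
  qed
  show "(SUP (a, k)\<in>affine_minorants S f. ereal (a \<bullet> x + k)) \<le> f x"
    using x by (auto simp: affine_minorants_def intro!: SUP_least)
qed

text \<open>The recession function is the support function of the domain of the conjugate. For the
  upper bound, a minorant at \<open>x + y\<close> splits into \<open>a \<bullet> x\<close> and its
  value at \<open>y\<close>, which is at most \<open>f y\<close>.\<close>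

lemma recession_eq_SUP_minorants:
  assumes f: "f \<in> Gamma0 S" and S: "subspace S" and x: "x \<in> S"
  shows "recession S f x = (SUP (a, k)\<in>affine_minorants S f. ereal (a \<bullet> x))"
proof (rule antisym)
  show "recession S f x \<le> (SUP (a, k)\<in>affine_minorants S f. ereal (a \<bullet> x))" (is "_ \<le> ?s")
    unfolding recession_def
  proof (rule SUP_least)
    fix y assume "y \<in> dom_on S f"
    then have y: "y \<in> S" "f y < \<infinity>" by (auto simp: dom_on_def)
    then obtain v where v: "f y = ereal v"
      using Gamma0_notMInf[OF f y(1)] by (cases "f y") auto
    have "x + y \<in> S" using S x y by (simp add: subspace_add)
    then have "f (x + y) = (SUP (a, k)\<in>affine_minorants S f. ereal (a \<bullet> (x + y) + k))"
      by (rule Gamma0_eq_SUP_minorants[OF f closed_subspace[OF S] subspace_imp_convex[OF S]])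
    also have "\<dots> \<le> ?s + ereal v"
    proof (rule SUP_least, clarify)
      fix a k assume ak: "(a, k) \<in> affine_minorants S f"
      then have "a \<bullet> y + k \<le> v" using y v by (auto simp: affine_minorants_def)
      then have "ereal (a \<bullet> (x + y) + k) \<le> ereal (a \<bullet> x) + ereal v" by (simp add: inner_add_right)
      also have "\<dots> \<le> ?s + ereal v"
        using ak by (intro add_right_mono SUP_upper2[of "(a, k)"]) auto
      finally show "ereal (a \<bullet> (x + y) + k) \<le> ?s + ereal v" .
    qed
    finally show "f (x + y) - f y \<le> ?s"
      unfolding v by (simp add: ereal_minus_le)
  qed
  show "?s \<le> recession S f x"
    using recession_ge_minorant[OF f S x] by (auto intro!: SUP_least)
qed

text \<open>Scaling a minorant by \<open>\<sigma>\<close> gives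
  \<open>a \<bullet> x + k * \<sigma>\<close>, and at \<open>\<sigma> = 0\<close> this is the
  formula for the recession function. One supremum thus covers both branches and makes the behaviour
  across \<open>\<sigma> = 0\<close> visible.\<close>

lemma perspective_eq_SUP_minorants:
  assumes f: "f \<in> Gamma0 S" and S: "subspace S" and x: "x \<in> S"
  shows "perspective S f (\<sigma>, x) =
    (if \<sigma> \<ge> 0 then (SUP (a, k)\<in>affine_minorants S f. ereal (a \<bullet> x + k * \<sigma>)) else \<infinity>)"
proof (cases "\<sigma> > 0")
  case True
  have "x /\<^sub>R \<sigma> \<in> S" using S x by (simp add: subspace_scale)
  then have fx: "f (x /\<^sub>R \<sigma>) = (SUP (a, k)\<in>affine_minorants S f. ereal (a \<bullet> (x /\<^sub>R \<sigma>) + k))"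
    by (rule Gamma0_eq_SUP_minorants[OF f closed_subspace[OF S] subspace_imp_convex[OF S]])
  have *: "\<sigma> * (a \<bullet> (x /\<^sub>R \<sigma>) + k) = a \<bullet> x + k * \<sigma>" for a k
    using True by (simp add: field_simps)
  have le: "ereal \<sigma> * u \<le> w \<longleftrightarrow> u \<le> w / ereal \<sigma>" for u w
    using True by (cases u; cases w) (auto simp: field_simps)
  have minorant_le: "ereal (a \<bullet> (x /\<^sub>R \<sigma>) + k) \<le> w / ereal \<sigma> \<longleftrightarrow> ereal (a \<bullet> x + k * \<sigma>) \<le> w" for a k w
    by (simp only: le[symmetric] times_ereal.simps *)
  \<comment> \<open>The factor passes through the supremum by comparing upper bounds
    \<open>w\<close>, since division by a positive \<open>\<sigma>\<close> preserves the
    order.\<close>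
  have "ereal \<sigma> * f (x /\<^sub>R \<sigma>) \<le> w \<longleftrightarrow>
    (SUP (a, k)\<in>affine_minorants S f. ereal (a \<bullet> x + k * \<sigma>)) \<le> w" for w
    unfolding le fx SUP_le_iff by (simp only: split_beta minorant_le)
  then have "ereal \<sigma> * f (x /\<^sub>R \<sigma>) = (SUP (a, k)\<in>affine_minorants S f. ereal (a \<bullet> x + k * \<sigma>))"
    by (meson antisym order_refl)
  then show ?thesis using True by (simp add: perspective_def)
next
  case False
  then show ?thesis
    by (auto simp: perspective_def recession_eq_SUP_minorants[OF f S x])
qed

text \<open>On \<open>\<sigma> \<ge> 0\<close> the perspective is a supremum of functions linear in
  \<open>(\<sigma>, x)\<close>; extending it by infinity off this closed convex set keeps convexity
  and semicontinuity. A single minorant of \<open>f\<close> excludes the value minus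
  infinity.\<close>

lemma perspective_Gamma0:
  assumes f: "f \<in> Gamma0 S" and S: "subspace S"
  shows "perspective S f \<in> Gamma0 (UNIV \<times> S)"
proof -
  note eq = perspective_eq_SUP_minorants[OF f S]
  obtain x0 f0 where x0: "x0 \<in> S" "f x0 = ereal f0"
    using Gamma0_finite_point[OF f] .
  have less: "ereal (f0 - 1) < f x0" using x0(2) by simp
  obtain a0 k0 where "\<And>y. y \<in> S \<Longrightarrow> ereal (a0 \<bullet> y + k0) \<le> f y"
    using Gamma0_affine_minorant[OF f closed_subspace[OF S] subspace_imp_convex[OF S] x0(1) less]
    by blast
  then have ak0: "(a0, k0) \<in> affine_minorants S f" by (simp add: affine_minorants_def)
  have ge: "ereal (a \<bullet> x + k * \<sigma>) \<le> perspective S f (\<sigma>, x)"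
    if "(a, k) \<in> affine_minorants S f" "x \<in> S" for a k \<sigma> x
    using that by (auto simp: eq intro!: SUP_upper2[of "(a, k)"])
  have nm: "perspective S f (\<sigma>, x) > -\<infinity>" if "x \<in> S" for \<sigma> x
    using ge[OF ak0 that, of \<sigma>] by auto
  have "proper_on (UNIV \<times> S) (perspective S f)"
    unfolding proper_on_def
  proof
    show "\<forall>x\<in>UNIV \<times> S. - \<infinity> < perspective S f x" using nm by auto
    have "perspective S f (1, x0) < \<infinity>" by (simp add: perspective_def x0)
    then show "dom_on (UNIV \<times> S) (perspective S f) \<noteq> {}"
      using x0(1) unfolding dom_on_def by blast
  qed
  moreover have "lsc_on (UNIV \<times> S) (perspective S f)"
  proof (rule lsc_onI_eventually, clarify)
    fix \<sigma> x c assume x: "x \<in> S" and c: "c < perspective S f (\<sigma>, x)"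
    let ?F = "at (\<sigma>, x) within UNIV \<times> S"
    have S_ev: "\<forall>\<^sub>F u in ?F. snd u \<in> S" by (auto simp: eventually_at_filter intro!: always_eventually)
    have lims: "(fst \<longlongrightarrow> \<sigma>) ?F" "(snd \<longlongrightarrow> x) ?F"
      by (auto intro!: tendsto_eq_intros)
    show "\<forall>\<^sub>F u in ?F. c < perspective S f u"
    proof (cases "\<sigma> < 0")
      case True
      \<comment> \<open>The half-space of negative first coordinates is open, and the perspective is
        infinite on it.\<close>
      then have "\<forall>\<^sub>F u in ?F. fst u < 0" using lims(1) by (simp add: order_tendstoD)
      then show ?thesis
        by eventually_elim (use c in \<open>auto simp: perspective_def split_beta\<close>)
    next
      case False
      then obtain a k where ak: "(a, k) \<in> affine_minorants S f" "c < ereal (a \<bullet> x + k * \<sigma>)"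
        using c by (auto simp: eq[OF x] less_SUP_iff)
      have "((\<lambda>u. ereal (a \<bullet> snd u + k * fst u)) \<longlongrightarrow> ereal (a \<bullet> x + k * \<sigma>)) ?F"
        by (intro tendsto_intros lims)
      then have "\<forall>\<^sub>F u in ?F. c < ereal (a \<bullet> snd u + k * fst u)"
        using order_tendstoD(1) ak(2) by blast
      then show ?thesis using S_ev
        by eventually_elim (use ge[OF ak(1)] in \<open>metis less_le_trans prod.collapse\<close>)
    qed
  qed
  moreover have "ereal_convex_on (UNIV \<times> S) (perspective S f)"
    unfolding ereal_convex_on_def
  proof (clarify)
    fix s1 x1 s2 x2 and t :: real
    assume x: "x1 \<in> S" "x2 \<in> S" and t: "t \<in> {0<..<1}"
    let ?s = "(1 - t) * s1 + t * s2" and ?x = "(1 - t) *\<^sub>R x1 + t *\<^sub>R x2"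
    have xS: "?x \<in> S" using S x by (simp add: subspace_add subspace_scale)
    have "perspective S f (?s, ?x)
        \<le> ereal (1 - t) * perspective S f (s1, x1) + ereal t * perspective S f (s2, x2)"
    proof (cases "s1 \<ge> 0 \<and> s2 \<ge> 0")
      case True
      then have "?s \<ge> 0" using t by simp
      then show ?thesis
        unfolding eq[OF xS]
      proof (simp, intro SUP_least, clarify)
        fix a k assume ak: "(a, k) \<in> affine_minorants S f"
        have "ereal (a \<bullet> ?x + k * ?s)
          = ereal (1 - t) * ereal (a \<bullet> x1 + k * s1) + ereal t * ereal (a \<bullet> x2 + k * s2)"
          by (simp add: inner_add_right algebra_simps)
        also have "\<dots> \<le> ereal (1 - t) * perspective S f (s1, x1) + ereal t * perspective S f (s2, x2)"
          using t ge[OF ak x(1)] ge[OF ak x(2)] by (intro add_mono ereal_mult_left_mono) auto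
        finally show "ereal (a \<bullet> ?x + k * ?s)
          \<le> ereal (1 - t) * perspective S f (s1, x1) + ereal t * perspective S f (s2, x2)" .
      qed
    next
      case False
      then have "perspective S f (s1, x1) = \<infinity> \<or> perspective S f (s2, x2) = \<infinity>"
        by (auto simp: perspective_def)
      then have "ereal (1 - t) * perspective S f (s1, x1) + ereal t * perspective S f (s2, x2) = \<infinity>"
        using t nm[OF x(1), of s1] nm[OF x(2), of s2]
        by (cases "perspective S f (s1, x1)"; cases "perspective S f (s2, x2)") auto
      then show ?thesis by (simp only: ereal_less_eq(1))
    qed
    then show "perspective S f ((1 - t) *\<^sub>R (s1, x1) + t *\<^sub>R (s2, x2))
        \<le> ereal (1 - t) * perspective S f (s1, x1) + ereal t * perspective S f (s2, x2)"
      by simp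
  qed
  ultimately show ?thesis by (simp add: Gamma0_def)
qed

subsection \<open>Subgradients orthogonal to a subspace\<close>

text \<open>Unlike \<open>Gamma0 UNIV\<close>, this admits an empty domain, so that the class is
  closed under sums.\<close>

definition closed_convex_fun :: "('a::euclidean_space \<Rightarrow> ereal) \<Rightarrow> bool" where
  "closed_convex_fun f \<longleftrightarrow> (\<forall>x. f x > -\<infinity>) \<and> lsc_on UNIV f \<and> ereal_convex_on UNIV f"

lemma ereal_convex_onD:
  "ereal_convex_on S f \<Longrightarrow> x \<in> S \<Longrightarrow> y \<in> S \<Longrightarrow> 0 < t \<Longrightarrow> t < 1 \<Longrightarrow>
    f ((1 - t) *\<^sub>R x + t *\<^sub>R y) \<le> ereal (1 - t) * f x + ereal t * f y"
  by (simp add: ereal_convex_on_def)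

lemma closed_convex_fun_add:
  fixes f g :: "'a::euclidean_space \<Rightarrow> ereal"
  assumes "closed_convex_fun f" "closed_convex_fun g"
  shows "closed_convex_fun (\<lambda>x. f x + g x)"
proof -
  have nm: "f x > -\<infinity>" "g x > -\<infinity>" for x
    using assms by (auto simp: closed_convex_fun_def)
  have "f x + g x > -\<infinity>" for x
    using nm[of x] by (cases "f x"; cases "g x") auto
  moreover have "lsc_on UNIV (\<lambda>x. f x + g x)"
    by (rule lsc_on_add) (use assms in \<open>auto simp: closed_convex_fun_def\<close>)
  moreover have "ereal_convex_on UNIV (\<lambda>x. f x + g x)"
    unfolding ereal_convex_on_def
  proof (intro ballI)
    fix x y :: 'a and t :: real assume t: "t \<in> {0<..<1}"
    let ?u = "(1 - t) *\<^sub>R x + t *\<^sub>R y"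
    have "f ?u + g ?u \<le> (ereal (1 - t) * f x + ereal t * f y) + (ereal (1 - t) * g x + ereal t * g y)"
      using t assms by (intro add_mono ereal_convex_onD) (auto simp: closed_convex_fun_def)
    also have "\<dots> = ereal (1 - t) * (f x + g x) + ereal t * (f y + g y)"
      using t nm[of x] nm[of y]
      by (cases "f x"; cases "f y"; cases "g x"; cases "g y") (auto simp: algebra_simps)
    finally show "f ?u + g ?u \<le> ereal (1 - t) * (f x + g x) + ereal t * (f y + g y)" .
  qed
  ultimately show ?thesis by (simp add: closed_convex_fun_def)
qed

lemma closed_convex_fun_sum:
  assumes "finite I" "\<And>i. i \<in> I \<Longrightarrow> closed_convex_fun (f i)"
  shows "closed_convex_fun (\<lambda>x. \<Sum>i\<in>I. f i x)"
  using assms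
proof (induction I)
  case empty
  have "lsc_on UNIV (\<lambda>x::'b. ereal 0)" by (rule lsc_on_continuous) simp
  then show ?case by (simp add: closed_convex_fun_def ereal_convex_on_def zero_ereal_def)
next
  case (insert i I)
  then show ?case by (simp add: closed_convex_fun_add)
qed

text \<open>This lifts a function that matters only on the subspace of one block to the whole
  product space; \<open>c\<close> accounts for the shift by \<open>y i\<close>.\<close>

lemma closed_convex_fun_affine_comp:
  fixes T :: "'a::euclidean_space \<Rightarrow> 'b::euclidean_space"
  assumes f: "f \<in> Gamma0 S" and T: "linear T" and S: "\<And>x. T x - c \<in> S"
  shows "closed_convex_fun (\<lambda>x. f (T x - c))"
proof -
  have "f (T x - c) > -\<infinity>" for x using Gamma0_notMInf[OF f S] .
  moreover have "lsc_on UNIV (\<lambda>x. f (T x - c))"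
  proof (rule lsc_onI_eventually)
    fix x e assume e: "e < f (T x - c)"
    have "\<forall>\<^sub>F y in at (T x - c) within S. e < f y"
      using f e S unfolding Gamma0_def lsc_on_def le_Liminf_iff by blast
    then obtain U where U: "open U" "T x - c \<in> U" "\<And>y. y \<in> U \<Longrightarrow> y \<in> S \<Longrightarrow> e < f y"
      unfolding eventually_at_topological using e by (metis (no_types, lifting))
    have "((\<lambda>y. T y - c) \<longlongrightarrow> T x - c) (at x within UNIV)"
      using linear_continuous_at[of T x] T
      by (intro tendsto_intros) (simp add: isCont_def linear_conv_bounded_linear)
    then have "\<forall>\<^sub>F y in at x within UNIV. T y - c \<in> U"
      using U(1,2) topological_tendstoD by blast
    then show "\<forall>\<^sub>F y in at x within UNIV. e < f (T y - c)"
      by eventually_elim (use U(3) S in blast)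
  qed
  moreover have "ereal_convex_on UNIV (\<lambda>x. f (T x - c))"
    unfolding ereal_convex_on_def
  proof (intro ballI)
    fix x y t assume t: "t \<in> {0<..<1::real}"
    have "T ((1 - t) *\<^sub>R x + t *\<^sub>R y) - c = (1 - t) *\<^sub>R (T x - c) + t *\<^sub>R (T y - c)"
      unfolding linear_add[OF T] linear_scale[OF T] by (simp add: algebra_simps)
    then show "f (T ((1 - t) *\<^sub>R x + t *\<^sub>R y) - c)
        \<le> ereal (1 - t) * f (T x - c) + ereal t * f (T y - c)"
      using ereal_convex_onD[of S f "T x - c" "T y - c" t] f S t by (simp add: Gamma0_def)
  qed
  ultimately show ?thesis by (simp add: closed_convex_fun_def)
qed

lemma closed_convex_fun_linear_comp:
  fixes T :: "'a::euclidean_space \<Rightarrow> 'b::euclidean_space"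
  assumes "f \<in> Gamma0 S" "linear T" "\<And>x. T x \<in> S"
  shows "closed_convex_fun (\<lambda>x. f (T x))"
  using closed_convex_fun_affine_comp[of f S T 0] assms by simp

lemma convex_dom_on:
  assumes "ereal_convex_on UNIV f"
  shows "convex (dom_on UNIV f)"
  unfolding convex_alt
proof (intro ballI allI impI)
  fix x y t assume x: "x \<in> dom_on UNIV f" and y: "y \<in> dom_on UNIV f" and t: "0 \<le> t \<and> t \<le> (1::real)"
  show "(1 - t) *\<^sub>R x + t *\<^sub>R y \<in> dom_on UNIV f"
  proof (cases "0 < t \<and> t < 1")
    case True
    then have "f ((1 - t) *\<^sub>R x + t *\<^sub>R y) \<le> ereal (1 - t) * f x + ereal t * f y"
      using assms by (simp add: ereal_convex_onD)
    also have "\<dots> < \<infinity>"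
      using x y True by (cases "f x"; cases "f y") (auto simp: dom_on_def)
    finally show ?thesis by (simp add: dom_on_def)
  next
    case False
    then have "t = 0 \<or> t = 1" using t by auto
    then show ?thesis using x y by auto
  qed
qed

text \<open>The set \<open>C\<close> below is the epigraph of the value function
  \<open>w \<mapsto> inf {F (w + v) - F x | v \<in> V}\<close>. The supporting hyperplane to it at the origin
  yields \<open>u\<close> unless it is vertical, which the relative interior condition excludes.\<close>

lemma subgradient_orthogonal_to_subspace:
  fixes F :: "'a::euclidean_space \<Rightarrow> ereal"
  assumes F: "\<And>x. F x > -\<infinity>" "ereal_convex_on UNIV F" and V: "subspace V"
    and ri: "V \<inter> rel_interior (dom_on UNIV F) \<noteq> {}"
    and x: "x \<in> V" and min: "\<And>y. y \<in> V \<Longrightarrow> F x \<le> F y"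
  obtains u where "\<bar>F x\<bar> \<noteq> \<infinity>" "\<And>v. v \<in> V \<Longrightarrow> u \<bullet> v = 0"
    "\<And>y. F x + ereal (u \<bullet> (y - x)) \<le> F y"
proof -
  obtain yb where yb: "yb \<in> V" "yb \<in> rel_interior (dom_on UNIV F)" using ri by blast
  then have "F yb < \<infinity>" using rel_interior_subset by (auto simp: dom_on_def)
  then have "F x < \<infinity>" using min[OF yb(1)] by auto
  then obtain m where m: "F x = ereal m" using F(1)[of x] by (cases "F x") auto
  define C where "C = {(w, r). \<exists>v\<in>V. F (w + v) \<le> ereal (m + r)}"
  have inC: "(y - v, r) \<in> C" if "F y \<le> ereal (m + r)" "v \<in> V" for y v r
    using that by (auto simp: C_def intro!: bexI[of _ v])
  have C0: "(0, r) \<in> C" if "r \<ge> 0" for r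
    using inC[OF _ x, of x r] m that by simp
  have C0': "r \<ge> 0" if r: "(0, r) \<in> C" for r
  proof -
    obtain v where "v \<in> V" "F v \<le> ereal (m + r)" using r by (auto simp: C_def)
    then have "ereal m \<le> ereal (m + r)" using min m by (metis order_trans)
    then show ?thesis by simp
  qed
  have "convex C"
    unfolding convex_alt
  proof (intro ballI allI impI, clarify)
    fix w1 r1 w2 r2 and t :: real
    assume a: "(w1, r1) \<in> C" "(w2, r2) \<in> C" and t: "0 \<le> t" "t \<le> 1"
    show "(1 - t) *\<^sub>R (w1, r1) + t *\<^sub>R (w2, r2) \<in> C"
    proof (cases "0 < t \<and> t < 1")
      case True
      obtain v1 v2 where v: "v1 \<in> V" "F (w1 + v1) \<le> ereal (m + r1)" "v2 \<in> V" "F (w2 + v2) \<le> ereal (m + r2)"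
        using a by (auto simp: C_def)
      have e: "(1 - t) *\<^sub>R w1 + t *\<^sub>R w2 + ((1 - t) *\<^sub>R v1 + t *\<^sub>R v2)
          = (1 - t) *\<^sub>R (w1 + v1) + t *\<^sub>R (w2 + v2)" by (simp add: algebra_simps)
      have "F ((1 - t) *\<^sub>R (w1 + v1) + t *\<^sub>R (w2 + v2))
          \<le> ereal (1 - t) * F (w1 + v1) + ereal t * F (w2 + v2)"
        using True F(2) by (simp add: ereal_convex_onD)
      also have "\<dots> \<le> ereal (1 - t) * ereal (m + r1) + ereal t * ereal (m + r2)"
        using True v by (intro add_mono ereal_mult_left_mono) auto
      also have "\<dots> = ereal (m + ((1 - t) * r1 + t * r2))" by (simp add: algebra_simps)
      finally show ?thesis
        unfolding C_def using V v(1,3)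
        by (auto simp: subspace_add subspace_scale e intro!: bexI[of _ "(1 - t) *\<^sub>R v1 + t *\<^sub>R v2"])
    next
      case False
      then have "t = 0 \<or> t = 1" using t by auto
      then show ?thesis using a by auto
    qed
  qed
  \<comment> \<open>From a relative interior point the segment that starts at \<open>(0, 1)\<close>
    could be prolonged beyond the origin, to a point \<open>(0, 1 - e)\<close> with negative second
    coordinate. Minimality of \<open>x\<close>, in the form \<open>C0'\<close>, forbids
    this.\<close>
  have "(0, 0) \<notin> rel_interior C"
  proof
    assume "(0, 0) \<in> rel_interior C"
    then obtain e where e: "e > 1" "(1 - e) *\<^sub>R (0, 1) + e *\<^sub>R (0, 0) \<in> C"
      using convex_rel_interior_if2[OF \<open>convex C\<close>] C0[of 1] hull_subset[of C affine]
      by (metis subsetD zero_le_one)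
    then show False using C0'[of "1 - e"] by simp
  qed
  moreover have "(0, 0) \<in> C" by (rule C0) simp
  ultimately obtain z where z: "z \<noteq> 0" "\<And>y. y \<in> C \<Longrightarrow> z \<bullet> (0, 0) \<le> z \<bullet> y"
     "\<And>y. y \<in> rel_interior C \<Longrightarrow> z \<bullet> (0, 0) < z \<bullet> y"
    using supporting_hyperplane_rel_boundary[OF \<open>convex C\<close>] by metis
  obtain a k where ak: "z = (a, k)" by (cases z)
  have supp: "0 \<le> a \<bullet> w + k * r" if "(w, r) \<in> C" for w r
    using z(2)[OF that] by (simp add: ak)
  have strict: "0 < a \<bullet> w + k * r" if "(w, r) \<in> rel_interior C" for w r
    using z(3)[OF that] by (simp add: ak)
  have k0: "0 \<le> k" using supp[OF C0[of 1]] by simp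
  \<comment> \<open>Moving the minimizer along \<open>V\<close> leaves \<open>C\<close> at height 0,
    so the functional is bounded below on a whole line; \<open>s = a \<bullet> v\<close> is the
    telling choice.\<close>
  have aV: "a \<bullet> v = 0" if v: "v \<in> V" for v
  proof -
    have "0 \<le> a \<bullet> (x - (x + s *\<^sub>R v))" for s
      using supp[OF inC[of x 0 "x + s *\<^sub>R v"]] m x v V by (simp add: subspace_add subspace_scale)
    from this[of "a \<bullet> v"] have "(a \<bullet> v) * (a \<bullet> v) \<le> 0" by simp
    then show ?thesis by (metis mult_le_0_iff order_antisym)
  qed
  \<comment> \<open>A vertical hyperplane would make \<open>a\<close> nonnegative on the domain and
    zero at the relative interior point \<open>yb\<close>. Then \<open>a\<close> vanishes on the
    domain, hence on all first components of \<open>C\<close>, against strict positivity on the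
    relative interior of \<open>C\<close>.\<close>
  have "k \<noteq> 0"
  proof
    assume k: "k = 0"
    have dom0: "a \<bullet> y \<ge> 0" if y: "y \<in> dom_on UNIV F" for y
    proof -
      obtain r where "F y = ereal r" using y F(1)[of y] by (cases "F y") (auto simp: dom_on_def)
      then show ?thesis
        using supp[OF inC[of y "r - m" x]] x aV[OF x] k by (simp add: inner_diff_right)
    qed
    have dom: "a \<bullet> y = 0" if y: "y \<in> dom_on UNIV F" for y
    proof -
      \<comment> \<open>The segment from \<open>y\<close> to \<open>yb\<close> is prolonged beyond
        \<open>yb\<close> inside the domain, where \<open>a\<close> has the opposite sign.\<close>
      obtain e where e: "e > 1" "(1 - e) *\<^sub>R y + e *\<^sub>R yb \<in> dom_on UNIV F"
        using convex_rel_interior_if2[OF convex_dom_on[OF F(2)] yb(2)] y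
          hull_subset[of "dom_on UNIV F" affine] by blast
      have "0 \<le> (1 - e) * (a \<bullet> y)"
        using dom0[OF e(2)] aV[OF yb(1)] by (simp add: inner_add_right)
      then show ?thesis using dom0[OF y] e(1) by (simp add: zero_le_mult_iff)
    qed
    obtain w r where wr: "(w, r) \<in> rel_interior C"
      using rel_interior_eq_empty[OF \<open>convex C\<close>] C0[of 0] by fastforce
    then have "(w, r) \<in> C" using rel_interior_subset by blast
    then obtain v where v: "v \<in> V" "F (w + v) \<le> ereal (m + r)" by (auto simp: C_def)
    then have "w + v \<in> dom_on UNIV F" by (auto simp: dom_on_def)
    then have "a \<bullet> w = 0" using dom[of "w + v"] aV[OF v(1)] by (simp add: inner_add_right)
    then show False using strict[OF wr] k by simp
  qed
  then have kp: "k > 0" using k0 by simp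
  show ?thesis
  \<comment> \<open>Dividing the supporting inequality by \<open>k\<close> gives the slope.\<close>
  proof (rule that[of "- (a /\<^sub>R k)"])
    show "\<bar>F x\<bar> \<noteq> \<infinity>" by (simp add: m)
    show "- (a /\<^sub>R k) \<bullet> v = 0" if "v \<in> V" for v using aV[OF that] by simp
    fix y
    show "F x + ereal (- (a /\<^sub>R k) \<bullet> (y - x)) \<le> F y"
    proof (cases "F y")
      case (real r)
      have "0 \<le> a \<bullet> (y - x) + k * (r - m)"
        using supp[OF inC[of y "r - m" x]] real x by simp
      then have "(a \<bullet> x - a \<bullet> y) / k \<le> r - m"
        by (subst pos_divide_le_eq[OF kp]) (simp add: inner_diff_right algebra_simps)
      then show ?thesis by (simp add: real m inner_diff_right divide_inverse algebra_simps)
    next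
      case MInf
      then show ?thesis using F(1)[of y] by simp
    qed simp
  qed
qed

subsection \<open>Douglas--Rachford iterations\<close>

text \<open>If \<open>a\<close> stayed above \<open>e\<close> from \<open>n\<close> on, the bounded
  weighted sums would bound the divergent sums of the weights. Since the weights may tend to 0,
  smallness is obtained only for arbitrarily late indices.\<close>

lemma weighted_sum_bounded_imp_frequently_small:
  fixes l a :: "nat \<Rightarrow> real"
  assumes l: "\<And>k. 0 \<le> l k" "filterlim (\<lambda>K. \<Sum>k<K. l k) at_top sequentially"
    and a: "\<And>k. 0 \<le> a k" and B: "\<And>K. (\<Sum>k<K. l k * a k) \<le> B" and "0 < e"
  shows "\<exists>k\<ge>n. a k < e"
proof (rule ccontr)
  assume "\<not> ?thesis"
  then have e: "e \<le> a k" if "k \<ge> n" for k using that by (meson not_le)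
  have "(\<Sum>k<K. l k) * e \<le> B + (\<Sum>k<n. l k) * e" for K
  proof -
    have "(\<Sum>k<K. l k) * e = (\<Sum>k<K. l k * e)" by (rule sum_distrib_right)
    \<comment> \<open>The extra term covers the first \<open>n\<close> indices, where
      \<open>a k\<close> may be below \<open>e\<close>.\<close>
    also have "\<dots> \<le> (\<Sum>k<K. l k * a k + (if k < n then l k * e else 0))"
    proof (rule sum_mono)
      fix k show "l k * e \<le> l k * a k + (if k < n then l k * e else 0)"
        using mult_left_mono[OF e l(1), of k k] l(1)[of k] a[of k] by auto
    qed
    also have "\<dots> = (\<Sum>k<K. l k * a k) + (\<Sum>k\<in>{..<K} \<inter> {k. k < n}. l k * e)"
      by (simp add: sum.distrib sum.If_cases)
    also have "\<dots> \<le> B + (\<Sum>k<n. l k * e)"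
      using l(1) \<open>0 < e\<close> by (intro add_mono B sum_mono2) auto
    finally show ?thesis by (simp add: sum_distrib_right)
  qed
  then have bd: "(\<Sum>k<K. l k) \<le> (B + (\<Sum>k<n. l k) * e) / e" for K
    using \<open>0 < e\<close> by (simp add: pos_le_divide_eq)
  have "\<forall>\<^sub>F K in sequentially. (B + (\<Sum>k<n. l k) * e) / e + 1 \<le> (\<Sum>k<K. l k)"
    using l(2) by (simp add: filterlim_at_top)
  then obtain K where "(B + (\<Sum>k<n. l k) * e) / e + 1 \<le> (\<Sum>k<K. l k)"
    by (metis eventually_sequentially order_refl)
  then show False using bd[of K] by linarith
qed

text \<open>When \<open>z\<close> is the resolvent of a monotone relation at \<open>2 p - w\<close> and the relation contains
  \<open>(x, u)\<close>, the point \<open>x - u\<close> is a fixed point of the Douglas--Rachford operator.\<close>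

lemma douglas_rachford_fejer_step:
  fixes w p z x u :: "'a::real_inner"
  assumes V: "subspace V" and p: "p \<in> V" "\<And>v. v \<in> V \<Longrightarrow> (w - p) \<bullet> v = 0"
    and x: "x \<in> V" "\<And>v. v \<in> V \<Longrightarrow> u \<bullet> v = 0"
    and mono: "0 \<le> ((2 *\<^sub>R p - w - z) - u) \<bullet> (z - x)" and m: "0 \<le> m"
  shows "(norm (w + m *\<^sub>R (z - p) - (x - u)))\<^sup>2
      \<le> (norm (w - (x - u)))\<^sup>2 - m * (2 - m) * (norm (z - p))\<^sup>2"
    and "norm (p - x) \<le> norm (w - (x - u))"
proof -
  have px: "p - x \<in> V" using V p x by (simp add: subspace_diff)
  \<comment> \<open>Here \<open>d\<close> lies in \<open>V\<close> and \<open>q\<close> is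
    orthogonal to \<open>V\<close>, so \<open>q + d\<close> is the orthogonal decomposition of the
    distance vector from the fixed point \<open>x - u\<close> to \<open>w\<close>.\<close>
  define e where "e = z - p"
  define d where "d = p - x"
  define q where "q = w - p + u"
  have qd: "q \<bullet> d = 0" using p(2)[OF px] x(2)[OF px] by (simp add: q_def d_def inner_add_left)
  have w: "w - (x - u) = q + d" by (simp add: q_def d_def)
  have "(2 *\<^sub>R p - w - z) - u = - q - e" "z - x = e + d"
    by (auto simp: q_def e_def d_def scaleR_2)
  then have "0 \<le> (- q - e) \<bullet> (e + d)" using mono by simp
  \<comment> \<open>As \<open>q\<close> and \<open>d\<close> are orthogonal, monotonicity bounds the
    cross term in the expansion of the squared distance; this is what produces the factor
    \<open>m * (2 - m)\<close>.\<close>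
  then have "e \<bullet> (q + d) \<le> - (e \<bullet> e)"
    using qd by (simp add: inner_add_right inner_diff_left inner_commute algebra_simps)
  then have "m * (e \<bullet> (q + d)) \<le> m * (- (e \<bullet> e))" using m by (rule mult_left_mono)
  moreover have step: "w + m *\<^sub>R e - (x - u) = (q + d) + m *\<^sub>R e"
    using w by (simp add: algebra_simps)
  moreover have "(norm ((q + d) + m *\<^sub>R e))\<^sup>2
      = (norm (q + d))\<^sup>2 + 2 * (m * (e \<bullet> (q + d))) + m * m * (norm e)\<^sup>2"
    by (simp only: power2_norm_eq_inner inner_add_left[of "q + d"] inner_add_right[of _ "q + d"]
        inner_scaleR_left inner_scaleR_right inner_commute[of "q + d" e])
      (simp add: algebra_simps)
  ultimately show "(norm (w + m *\<^sub>R (z - p) - (x - u)))\<^sup>2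
      \<le> (norm (w - (x - u)))\<^sup>2 - m * (2 - m) * (norm (z - p))\<^sup>2"
    unfolding step w e_def[symmetric] power2_norm_eq_inner[of e] by (simp add: algebra_simps)
  have "(norm (q + d))\<^sup>2 = (norm q)\<^sup>2 + (norm d)\<^sup>2"
    using qd by (simp add: norm_add_Pythagorean orthogonal_def)
  then have "(norm d)\<^sup>2 \<le> (norm (q + d))\<^sup>2" by simp
  then show "norm (p - x) \<le> norm (w - (x - u))"
    unfolding w d_def[symmetric] by (rule power2_le_imp_le) simp
qed

text \<open>Monotonicity of \<open>M\<close> makes distances to fixed points decrease, and
  closedness of \<open>M\<close> carries the resolvent relation to a cluster point along indices
  with small residual. That cluster point is a fixed point, and the decreasing distance to it then
  tends to 0 along the whole sequence.\<close>

theorem douglas_rachford_convergence: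
  fixes M :: "('a::euclidean_space \<times> 'a) set" and w p z :: "nat \<Rightarrow> 'a"
  assumes V: "subspace V"
    and mono: "\<And>a s b t. (a, s) \<in> M \<Longrightarrow> (b, t) \<in> M \<Longrightarrow> 0 \<le> (s - t) \<bullet> (a - b)"
    and M: "closed M"
    and zero: "\<exists>x u. x \<in> V \<and> (\<forall>v\<in>V. u \<bullet> v = 0) \<and> (x, u) \<in> M"
    and \<mu>: "\<And>k. 0 < \<mu> k \<and> \<mu> k < 2" "filterlim (\<lambda>K. \<Sum>k<K. \<mu> k * (2 - \<mu> k)) at_top sequentially"
    and p: "\<And>k. p k \<in> V" "\<And>k v. v \<in> V \<Longrightarrow> (w k - p k) \<bullet> v = 0"
    and z: "\<And>k. (z k, 2 *\<^sub>R p k - w k - z k) \<in> M"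
    and w: "\<And>k. w (Suc k) = w k + \<mu> k *\<^sub>R (z k - p k)"
  obtains x u where "p \<longlonglongrightarrow> x" "x \<in> V" "\<And>v. v \<in> V \<Longrightarrow> u \<bullet> v = 0" "(x, u) \<in> M"
proof -
  have fejer: "(norm (w (Suc k) - (x - u)))\<^sup>2
        \<le> (norm (w k - (x - u)))\<^sup>2 - \<mu> k * (2 - \<mu> k) * (norm (z k - p k))\<^sup>2"
    and contr: "norm (p k - x) \<le> norm (w k - (x - u))"
    if x: "x \<in> V" "\<forall>v\<in>V. u \<bullet> v = 0" "(x, u) \<in> M" for x u k
    using douglas_rachford_fejer_step[OF V p(1) p(2)[where k = k] x(1) bspec[OF x(2)] mono[OF z[of k] x(3)],
        of "\<mu> k"]
      \<mu>(1)[of k] unfolding w by auto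
  have l0: "0 \<le> \<mu> k * (2 - \<mu> k)" for k using \<mu>(1)[of k] by simp
  have dec: "norm (w (k + j) - (x - u)) \<le> norm (w k - (x - u))"
    if x: "x \<in> V" "\<forall>v\<in>V. u \<bullet> v = 0" "(x, u) \<in> M" for x u k j
  proof (induction j)
    case (Suc j)
    have "(norm (w (Suc (k + j)) - (x - u)))\<^sup>2 \<le> (norm (w (k + j) - (x - u)))\<^sup>2"
      using fejer[OF x, of "k + j"] 
        mult_nonneg_nonneg[OF l0[of "k + j"] zero_le_power2[of "norm (z (k + j) - p (k + j))"]]
      by linarith
    then have "norm (w (Suc (k + j)) - (x - u)) \<le> norm (w (k + j) - (x - u))"
      by (rule power2_le_imp_le) simp
    then show ?case using Suc by simp
  qed simp
  obtain x0 u0 where x0: "x0 \<in> V" "\<forall>v\<in>V. u0 \<bullet> v = 0" "(x0, u0) \<in> M" using zero by blast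
  define D where "D = norm (w 0 - (x0 - u0))"
  have bw: "norm (w k - (x0 - u0)) \<le> D" for k using dec[OF x0, of 0 k] by (simp add: D_def)
  have bp: "norm (p k - x0) \<le> D" for k using contr[OF x0, of k] bw[of k] by simp
  \<comment> \<open>The inequalities \<open>fejer\<close> telescope.\<close>
  have "(\<Sum>k<K. \<mu> k * (2 - \<mu> k) * (norm (z k - p k))\<^sup>2) \<le> D\<^sup>2 - (norm (w K - (x0 - u0)))\<^sup>2" for K
  proof (induction K)
    case (Suc K)
    then show ?case using fejer[OF x0, of K] by simp
  qed (simp add: D_def)
  then have "(\<Sum>k<K. \<mu> k * (2 - \<mu> k) * (norm (z k - p k))\<^sup>2) \<le> D\<^sup>2" for K
    by (smt (verit, best) zero_le_power2)
  then have "\<exists>k\<ge>n. (norm (z k - p k))\<^sup>2 < (inverse (real (Suc n)))\<^sup>2" for n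
    by (intro weighted_sum_bounded_imp_frequently_small[OF l0 \<mu>(2)]) auto
  then have "\<exists>k\<ge>n. norm (z k - p k) < inverse (real (Suc n))" for n
    by (metis inverse_nonnegative_iff_nonnegative of_nat_0_le_iff power2_less_imp_less)
  \<comment> \<open>The map \<open>r\<close> is not claimed to be increasing: convergence of
    \<open>w\<close> will use only that some \<open>w (r (s n))\<close> comes close to the
    limit.\<close>
  then obtain r where r: "\<And>n. r n \<ge> n" "\<And>n. norm (z (r n) - p (r n)) < inverse (real (Suc n))"
    by metis
  have "(\<lambda>n. z (r n) - p (r n)) \<longlonglongrightarrow> 0"
  proof (rule Lim_null_comparison)
    show "\<forall>\<^sub>F n in sequentially. norm (z (r n) - p (r n)) \<le> inverse (real (Suc n))"
      using r(2) by (intro always_eventually allI less_imp_le)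
  qed (rule LIMSEQ_inverse_real_of_nat)
  note e0 = this
  have "bounded (range (\<lambda>n. (w (r n), p (r n))))"
  proof -
    have "bounded (range (\<lambda>n. w (r n)))"
      by (rule bounded_subset[OF bounded_cball[of "x0 - u0" D]])
        (use bw in \<open>auto simp: dist_norm norm_minus_commute[of "x0 - u0"]\<close>)
    moreover have "bounded (range (\<lambda>n. p (r n)))"
      by (rule bounded_subset[OF bounded_cball[of x0 D]])
        (use bp in \<open>auto simp: dist_norm norm_minus_commute[of x0]\<close>)
    ultimately have "bounded (range (\<lambda>n. w (r n)) \<times> range (\<lambda>n. p (r n)))" by (rule bounded_Times)
    then show ?thesis by (rule bounded_subset) auto
  qed
  then obtain l s where s: "strict_mono (s :: nat \<Rightarrow> nat)" "((\<lambda>n. (w (r n), p (r n))) \<circ> s) \<longlonglongrightarrow> l"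
    using bounded_imp_convergent_subsequence by blast
  obtain wl pl where l: "l = (wl, pl)" by (cases l)
  have lim: "(\<lambda>n. w (r (s n))) \<longlonglongrightarrow> wl" "(\<lambda>n. p (r (s n))) \<longlonglongrightarrow> pl"
    using tendsto_fst[OF s(2)] tendsto_snd[OF s(2)] by (auto simp: l o_def)
  have e1: "(\<lambda>n. z (r (s n)) - p (r (s n))) \<longlonglongrightarrow> 0"
    using LIMSEQ_subseq_LIMSEQ[OF e0 s(1)] by (simp add: o_def)
  have limz: "(\<lambda>n. z (r (s n))) \<longlonglongrightarrow> pl"
    using tendsto_add[OF e1 lim(2)] by simp
  have "(\<lambda>n. (z (r (s n)), 2 *\<^sub>R p (r (s n)) - w (r (s n)) - z (r (s n)))) \<longlonglongrightarrow> (pl, 2 *\<^sub>R pl - wl - pl)"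
    by (intro tendsto_intros lim limz)
  then have "(pl, 2 *\<^sub>R pl - wl - pl) \<in> M"
    by (rule closed_sequentially[OF M z])
  then have inM: "(pl, pl - wl) \<in> M" by (simp add: scaleR_2)
  have plV: "pl \<in> V"
    by (rule closed_sequentially[OF closed_subspace[OF V] p(1) lim(2)])
  have perp: "(pl - wl) \<bullet> v = 0" if v: "v \<in> V" for v
  proof -
    have "(\<lambda>n. (w (r (s n)) - p (r (s n))) \<bullet> v) \<longlonglongrightarrow> (wl - pl) \<bullet> v"
      by (intro tendsto_intros lim)
    then have "(wl - pl) \<bullet> v = 0" using p(2)[OF v] by (simp add: LIMSEQ_const_iff)
    then show ?thesis by (simp add: inner_diff_left)
  qed
  then have perp': "\<forall>v\<in>V. (pl - wl) \<bullet> v = 0" by blast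
  \<comment> \<open>The fixed point belonging to the pair \<open>(pl, pl - wl)\<close> is
    \<open>wl\<close>, so \<open>dec\<close> applies to the distance from \<open>wl\<close>: once
    small, it stays small.\<close>
  have "w \<longlonglongrightarrow> wl"
  proof (rule LIMSEQ_I)
    fix e :: real assume "0 < e"
    then obtain n where n: "norm (w (r (s n)) - wl) < e"
      using LIMSEQ_D[OF lim(1)] by blast
    have "norm (w k - wl) < e" if "k \<ge> r (s n)" for k
      using dec[OF plV perp' inM, of "r (s n)" "k - r (s n)"] that n by simp
    then show "\<exists>no. \<forall>k\<ge>no. norm (w k - wl) < e" by blast
  qed
  then have "(\<lambda>k. norm (w k - wl)) \<longlonglongrightarrow> 0" by (simp add: LIM_zero tendsto_norm_zero)
  moreover have "norm (p k - pl) \<le> norm (w k - wl)" for k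
    using contr[OF plV perp' inM, of k] by simp
  ultimately have "(\<lambda>k. p k - pl) \<longlonglongrightarrow> 0"
    by (intro Lim_null_comparison[of "\<lambda>k. p k - pl" "\<lambda>k. norm (w k - wl)"]) auto
  then have "p \<longlonglongrightarrow> pl" by (rule LIM_zero_cancel)
  then show ?thesis using that plV perp inM by blast
qed

subsection \<open>Block structure\<close>

text \<open>The subdifferential of \<open>c F\<close> for \<open>c > 0\<close>, written without a product in \<open>ereal\<close>.\<close>

definition scaled_subdifferential :: "real \<Rightarrow> ('a::euclidean_space \<Rightarrow> ereal) \<Rightarrow> ('a \<times> 'a) set" where
  "scaled_subdifferential c F =
    {(a, u). \<bar>F a\<bar> \<noteq> \<infinity> \<and> (\<forall>b. F a + ereal (u \<bullet> (b - a) / c) \<le> F b)}"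

lemma scaled_subdifferential_monotone:
  assumes "0 < c" "(a, s) \<in> scaled_subdifferential c F" "(b, t) \<in> scaled_subdifferential c F"
  shows "0 \<le> (s - t) \<bullet> (a - b)"
proof -
  obtain fa fb where f: "F a = ereal fa" "F b = ereal fb"
    using assms(2,3) by (auto simp: scaled_subdifferential_def)
  have "fa + s \<bullet> (b - a) / c \<le> fb" "fb + t \<bullet> (a - b) / c \<le> fa"
    using assms(2,3) f by (auto simp: scaled_subdifferential_def dest: spec[of _ a] spec[of _ b])
  then have "(s \<bullet> (b - a) + t \<bullet> (a - b)) / c \<le> 0" by (simp add: add_divide_distrib)
  then have "s \<bullet> (b - a) + t \<bullet> (a - b) \<le> 0" using assms(1) by (simp add: divide_le_0_iff)
  then show ?thesis by (simp add: algebra_simps)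
qed

text \<open>With \<open>b\<close> fixed, semicontinuity at the limit of the base points and
  continuity of the inner product suffice. A point where \<open>F\<close> is finite shows that
  \<open>F\<close> is finite at the limit.\<close>

lemma scaled_subdifferential_closed:
  assumes F: "\<And>x. F x > -\<infinity>" "lsc_on UNIV F" and dom: "dom_on UNIV F \<noteq> {}"
  shows "closed (scaled_subdifferential c F)"
  unfolding closed_sequential_limits
proof (intro allI impI, elim conjE)
  fix v l assume v: "\<forall>n. v n \<in> scaled_subdifferential c F" and lim: "v \<longlonglongrightarrow> l"
  obtain a u where l: "l = (a, u)" by (cases l)
  define an un where "an n = fst (v n)" and "un n = snd (v n)" for n
  have la: "an \<longlonglongrightarrow> a" and lu: "un \<longlonglongrightarrow> u"
    using tendsto_fst[OF lim] tendsto_snd[OF lim] by (simp_all add: l an_def[abs_def] un_def[abs_def])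
  have sub: "F (an n) + ereal (un n \<bullet> (b - an n) / c) \<le> F b" for n b
    using v[rule_format, of n] by (auto simp: scaled_subdifferential_def an_def un_def split_beta)
  have le: "F a \<le> ereal (r - u \<bullet> (b - a) / c)" if b: "F b = ereal r" for b r
  proof (rule lsc_on_bounded_limit[OF F(2)])
    show "an \<longlonglongrightarrow> a" by (rule la)
    show "F (an n) \<le> ereal (r - un n \<bullet> (b - an n) / c)" for n
      using sub[of n b] b by (cases "F (an n)") auto
    show "(\<lambda>n. r - un n \<bullet> (b - an n) / c) \<longlonglongrightarrow> r - u \<bullet> (b - a) / c"
      unfolding divide_inverse by (intro tendsto_intros la lu)
  qed auto
  obtain b0 r0 where "F b0 = ereal r0"
    using dom F(1) unfolding dom_on_def
    by (metis (mono_tags, lifting) Collect_empty_eq ereal_cases less_irrefl)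
  then have fin: "\<bar>F a\<bar> \<noteq> \<infinity>" using le[of b0 r0] F(1)[of a] by (cases "F a") auto
  moreover have "F a + ereal (u \<bullet> (b - a) / c) \<le> F b" for b
  proof (cases "F b")
    case (real r)
    then show ?thesis using le[OF real] fin by (cases "F a") auto
  qed (use F(1)[of b] in auto)
  ultimately show "l \<in> scaled_subdifferential c F" by (simp add: l scaled_subdifferential_def)
qed

lemma subspace_block_space: "subspace (block_space \<beta> r)"
  by (simp add: subspace_def block_space_def)

lemma block_in_block_space: "block \<beta> r z \<in> block_space \<beta> r"
  by (simp add: block_def block_space_def)

lemma block_add: "block \<beta> r (x + y) = block \<beta> r x + block \<beta> r y"
  and block_diff: "block \<beta> r (x - y) = block \<beta> r x - block \<beta> r y"
  and block_scale: "block \<beta> r (a *\<^sub>R x) = a *\<^sub>R block \<beta> r x"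
  by (auto simp: block_def vec_eq_iff)

lemma block_eqI:
  fixes a c :: "real^'m::finite"
  assumes "\<And>r. block \<beta> r a = block \<beta> r c"
  shows "a = c"
proof (rule vec_eq_iff[THEN iffD2], rule allI)
  fix j show "a $ j = c $ j"
    using arg_cong[OF assms[of "\<beta> j"], of "\<lambda>v. v $ j"] by (simp add: block_def)
qed

text \<open>The fibres of \<open>\<beta>\<close> partition the coordinates, which lets blockwise
  subgradient inequalities add up.\<close>

lemma inner_eq_sum_block:
  fixes \<beta> :: "'m::finite \<Rightarrow> 'N::finite + 'P::finite"
  shows "a \<bullet> c = (\<Sum>i\<in>UNIV. block \<beta> (Inl i) a \<bullet> block \<beta> (Inl i) c)
      + (\<Sum>i\<in>UNIV. block \<beta> (Inr i) a \<bullet> block \<beta> (Inr i) c)"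
proof -
  have "a \<bullet> c = (\<Sum>j\<in>UNIV. \<Sum>r\<in>UNIV. if \<beta> j = r then a $ j * c $ j else 0)"
    by (simp add: inner_vec_def)
  also have "\<dots> = (\<Sum>r\<in>UNIV. \<Sum>j\<in>UNIV. if \<beta> j = r then a $ j * c $ j else 0)"
    by (rule sum.swap)
  also have "\<dots> = (\<Sum>r\<in>UNIV. block \<beta> r a \<bullet> block \<beta> r c)"
    unfolding inner_vec_def block_def by (intro sum.cong) auto
  also have "\<dots> = (\<Sum>i\<in>UNIV. block \<beta> (Inl i) a \<bullet> block \<beta> (Inl i) c)
      + (\<Sum>i\<in>UNIV. block \<beta> (Inr i) a \<bullet> block \<beta> (Inr i) c)"
    using sum.Plus[of "UNIV :: 'N set" "UNIV :: 'P set" "\<lambda>r. block \<beta> r a \<bullet> block \<beta> r c"]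
    by (simp add: o_def)
  finally show ?thesis .
qed

lemma block_stack:
  assumes "\<And>i. X i \<in> block_matrices \<beta> (Inl i)" "\<And>i. L i \<in> block_matrices \<beta> (Inr i)"
  shows "block \<beta> (Inl i) (stack \<beta> X L *v b) = X i *v b"
    and "block \<beta> (Inr i') (stack \<beta> X L *v b) = L i' *v b"
  using assms
  by (auto simp: vec_eq_iff block_def stack_def matrix_vector_mult_def block_matrices_def row_def)

section \<open>Orthogonal projection onto the graph of a matrix\<close>

lemma matrix_inv_right_inverse: "invertible A \<Longrightarrow> A ** matrix_inv A = mat 1"
  unfolding invertible_def matrix_inv_def by (rule someI2_ex) auto

text \<open>Pairing a kernel vector \<open>x\<close> with its image gives the sum of the squared
  norms of \<open>x\<close> and \<open>transpose A *v x\<close>, so \<open>x\<close>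
  vanishes.\<close>

lemma invertible_mat_1_plus_gram:
  fixes A :: "real^'p::finite^'m::finite"
  shows "invertible (mat 1 + A ** transpose A)"
  unfolding invertible_left_inverse matrix_left_invertible_ker
proof (intro allI impI)
  fix x assume "(mat 1 + A ** transpose A) *v x = 0"
  then have "x + A *v (transpose A *v x) = 0"
    by (simp only: matrix_vector_mult_add_rdistrib matrix_vector_mul_lid matrix_vector_mul_assoc)
  then have "x \<bullet> (x + A *v (transpose A *v x)) = 0" by simp
  then have "x \<bullet> x + (transpose A *v x) \<bullet> (transpose A *v x) = 0"
    by (simp add: inner_add_right flip: dot_lmul_matrix)
  then have "x \<bullet> x = 0" using inner_ge_zero[of x] inner_ge_zero[of "transpose A *v x"] by linarith
  then show "x = 0" by simp
qed

text \<open>The point \<open>(b, A *v b)\<close> is the projection of \<open>(x, h)\<close> onto the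
  graph of \<open>A\<close>. With \<open>r\<close> the solution of the linear system for
  \<open>A *v x - h\<close>, the displacement is \<open>(transpose A *v r, - r)\<close>, the general
  form of a vector orthogonal to the graph.\<close>

lemma graph_projection_orthogonal:
  fixes A :: "real^'p::finite^'m::finite"
  assumes Q: "Q = transpose A ** matrix_inv (mat 1 + A ** transpose A)"
    and b: "b = x - Q *v (A *v x - h)"
  shows "(x - b) \<bullet> b' + (h - A *v b) \<bullet> (A *v b') = 0"
proof -
  define q where "q = A *v x - h"
  define r where "r = matrix_inv (mat 1 + A ** transpose A) *v q"
  have "(mat 1 + A ** transpose A) *v r = q"
    unfolding r_def matrix_vector_mul_assoc
      matrix_inv_right_inverse[OF invertible_mat_1_plus_gram] by simp
  then have q: "q = r + A *v (transpose A *v r)"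
    by (simp only: matrix_vector_mult_add_rdistrib matrix_vector_mul_lid matrix_vector_mul_assoc)
  have xb: "x - b = transpose A *v r"
    by (simp add: b Q r_def q_def matrix_vector_mul_assoc)
  then have "b = x - transpose A *v r" by (simp add: algebra_simps)
  then have "A *v b = A *v x - A *v (transpose A *v r)" by (simp only: matrix_vector_mult_diff_distrib)
  then have "h - A *v b = - r" using q by (simp add: q_def algebra_simps)
  then show ?thesis unfolding xb by (simp add: dot_lmul_matrix)
qed

lemma subspace_bold_V:
  fixes A :: "real^'p::finite^'m::finite"
  shows "subspace (bold_V (bold_L A) :: (('v::real_vector \<times> _) \<times> _) set)"
  by (auto simp: subspace_def bold_V_def bold_L_def matrix_vector_right_distrib
      matrix_vector_mult_scaleR zero_prod_def)

section \<open>The separable function on the product space\<close>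

type_synonym ('N, 'P, 'p, 'm) product_space =
  "(((real^'N) \<times> (real^'P)) \<times> (real^'p)) \<times> (((real^'N) \<times> (real^'P)) \<times> (real^'m))"

text \<open>Each summand is a \<open>Gamma0\<close> function, or a perspective of one, composed with
  a linear or affine map of the full product variable.\<close>

lemma closed_convex_fun_bold_F:
  fixes \<beta> :: "'m::finite \<Rightarrow> 'N::finite + 'P::finite" and \<zeta> :: "real^'N \<Rightarrow> ereal"
    and \<omega> :: "real^'P \<Rightarrow> ereal" and \<theta> :: "real^'p::finite \<Rightarrow> ereal"
  assumes "\<zeta> \<in> Gamma0 UNIV" "\<omega> \<in> Gamma0 UNIV" "\<theta> \<in> Gamma0 UNIV"
    and \<phi>: "\<And>i. \<phi> i \<in> Gamma0 (block_space \<beta> (Inl i))"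
    and y: "\<And>i. y i \<in> block_space \<beta> (Inl i)"
    and \<psi>: "\<And>i. \<psi> i \<in> Gamma0 (block_space \<beta> (Inr i))"
  shows "closed_convex_fun (bold_F (bold_f \<zeta> \<omega> \<theta>) (bold_g \<beta> \<phi> y \<psi>))"
proof -
  have lin: "linear (\<lambda>u :: ('N, 'P, 'p, 'm) product_space.
      (fst (fst (snd u)) $ i, block \<beta> r (snd (snd u))))"
    "linear (\<lambda>u :: ('N, 'P, 'p, 'm) product_space.
      (snd (fst (snd u)) $ i', block \<beta> r (snd (snd u))))"
    for i i' r
    by (rule linearI; simp add: block_add block_scale)+
  have f: "closed_convex_fun (\<lambda>u :: ('N, 'P, 'p, 'm) product_space. \<zeta> (fst (fst (fst u))) + \<omega> (snd (fst (fst u))) + \<theta> (snd (fst u)))"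
    using assms(1-3) by (intro closed_convex_fun_add closed_convex_fun_linear_comp[where S = UNIV])
      (auto intro!: linearI)
  have g1: "closed_convex_fun (\<lambda>u :: ('N, 'P, 'p, 'm) product_space. \<Sum>i\<in>UNIV. perspective (block_space \<beta> (Inl i)) (\<phi> i)
      ((fst (fst (snd u)) $ i, block \<beta> (Inl i) (snd (snd u))) - (0, y i)))"
    by (rule closed_convex_fun_sum[OF finite],
        rule closed_convex_fun_affine_comp[OF perspective_Gamma0[OF \<phi> subspace_block_space] lin(1)])
      (simp add: subspace_diff[OF subspace_block_space] block_in_block_space y)
  have g2: "closed_convex_fun (\<lambda>u :: ('N, 'P, 'p, 'm) product_space. \<Sum>i\<in>UNIV. perspective (block_space \<beta> (Inr i)) (\<psi> i)
      (snd (fst (snd u)) $ i, block \<beta> (Inr i) (snd (snd u))))"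
    by (rule closed_convex_fun_sum[OF finite],
        rule closed_convex_fun_linear_comp[OF perspective_Gamma0[OF \<psi> subspace_block_space] lin(2)])
      (simp add: block_in_block_space)
  have "bold_F (bold_f \<zeta> \<omega> \<theta>) (bold_g \<beta> \<phi> y \<psi>) =
    (\<lambda>u. (\<zeta> (fst (fst (fst u))) + \<omega> (snd (fst (fst u))) + \<theta> (snd (fst u))) +
      ((\<Sum>i\<in>UNIV. perspective (block_space \<beta> (Inl i)) (\<phi> i)
        ((fst (fst (snd u)) $ i, block \<beta> (Inl i) (snd (snd u))) - (0, y i)))
      + (\<Sum>i\<in>UNIV. perspective (block_space \<beta> (Inr i)) (\<psi> i)
        (snd (fst (snd u)) $ i, block \<beta> (Inr i) (snd (snd u))))))"
    by (auto simp: bold_F_def bold_f_def bold_g_def fun_eq_iff)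
  then show ?thesis using f g1 g2 by (simp add: closed_convex_fun_add)
qed

lemma ereal_add_finite: "\<bar>a\<bar> \<noteq> \<infinity> \<Longrightarrow> \<bar>b\<bar> \<noteq> \<infinity> \<Longrightarrow> \<bar>a + b :: ereal\<bar> \<noteq> \<infinity>"
  by (cases a; cases b) auto

text \<open>Since the function is separable, componentwise subgradient inequalities may be added.
  The scalar coordinate \<open>i\<close> and the block \<open>i\<close> are taken together because
  the perspective couples them.\<close>

lemma bold_F_scaled_subdifferentialI:
  fixes \<beta> :: "'m::finite \<Rightarrow> 'N::finite + 'P::finite"
    and us vs zs ds :: "real^'N" and ut vt zt dt :: "real^'P" and ub zb :: "real^'p::finite"
    and vb db :: "real^'m" and \<phi> :: "'N \<Rightarrow> real^'m \<Rightarrow> ereal" and \<psi> :: "'P \<Rightarrow> real^'m \<Rightarrow> ereal"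
  defines "P \<equiv> \<lambda>i. perspective (block_space \<beta> (Inl i)) (\<phi> i)"
    and "R \<equiv> \<lambda>i. perspective (block_space \<beta> (Inr i)) (\<psi> i)"
  assumes y: "\<And>i. y i \<in> block_space \<beta> (Inl i)"
    and s: "\<bar>\<zeta> zs\<bar> \<noteq> \<infinity>" "\<And>x. \<zeta> zs + ereal (us \<bullet> (x - zs) / c) \<le> \<zeta> x"
    and t: "\<bar>\<omega> zt\<bar> \<noteq> \<infinity>" "\<And>x. \<omega> zt + ereal (ut \<bullet> (x - zt) / c) \<le> \<omega> x"
    and b: "\<bar>\<theta> zb\<bar> \<noteq> \<infinity>" "\<And>x. \<theta> zb + ereal (ub \<bullet> (x - zb) / c) \<le> \<theta> x"
    and p: "\<And>i. \<bar>P i (ds $ i, block \<beta> (Inl i) db - y i)\<bar> \<noteq> \<infinity>"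
      "\<And>i x. x \<in> UNIV \<times> block_space \<beta> (Inl i) \<Longrightarrow> P i (ds $ i, block \<beta> (Inl i) db - y i)
        + ereal ((vs $ i, block \<beta> (Inl i) vb) \<bullet> (x - (ds $ i, block \<beta> (Inl i) db - y i)) / c) \<le> P i x"
    and r: "\<And>i. \<bar>R i (dt $ i, block \<beta> (Inr i) db)\<bar> \<noteq> \<infinity>"
      "\<And>i x. x \<in> UNIV \<times> block_space \<beta> (Inr i) \<Longrightarrow> R i (dt $ i, block \<beta> (Inr i) db)
        + ereal ((vt $ i, block \<beta> (Inr i) vb) \<bullet> (x - (dt $ i, block \<beta> (Inr i) db)) / c) \<le> R i x"
  shows "((((zs, zt), zb), ((ds, dt), db)), (((us, ut), ub), ((vs, vt), vb)))
    \<in> scaled_subdifferential c (bold_F (bold_f \<zeta> \<omega> \<theta>) (bold_g \<beta> \<phi> y \<psi>))"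
proof -
  let ?F = "bold_F (bold_f \<zeta> \<omega> \<theta>) (bold_g \<beta> \<phi> y \<psi>)"
  let ?z = "(((zs, zt), zb), ((ds, dt), db))" and ?u = "(((us, ut), ub), ((vs, vt), vb))"
  have F: "?F (((xs, xt), xb), ((es, et), eb)) = \<zeta> xs + \<omega> xt + \<theta> xb
     + ((\<Sum>i\<in>UNIV. P i (es $ i, block \<beta> (Inl i) eb - y i))
     + (\<Sum>i\<in>UNIV. R i (et $ i, block \<beta> (Inr i) eb)))" for xs xt xb es et eb
    by (simp add: bold_F_def bold_f_def bold_g_def P_def R_def)
  have "\<bar>?F ?z\<bar> \<noteq> \<infinity>"
    unfolding F by (intro ereal_add_finite s t b) (simp_all add: sum_Inf p r)
  moreover have "?F ?z + ereal (?u \<bullet> (x - ?z) / c) \<le> ?F x" for x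
  proof -
    obtain xs xt xb es et eb where x: "x = (((xs, xt), xb), ((es, et), eb))"
      by (metis surj_pair)
    \<comment> \<open>\<open>qp i\<close> and \<open>qr i\<close> are the shares of the pairs
      (coordinate, block) in the inner product divided by \<open>c\<close>.\<close>
    define qp where "qp i = (vs $ i * (es $ i - ds $ i)
        + block \<beta> (Inl i) vb \<bullet> block \<beta> (Inl i) (eb - db)) / c" for i
    define qr where "qr i = (vt $ i * (et $ i - dt $ i)
        + block \<beta> (Inr i) vb \<bullet> block \<beta> (Inr i) (eb - db)) / c" for i
    have P: "P i (ds $ i, block \<beta> (Inl i) db - y i) + ereal (qp i)
        \<le> P i (es $ i, block \<beta> (Inl i) eb - y i)" for i
      using p(2)[of "(es $ i, block \<beta> (Inl i) eb - y i)" i]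
      by (simp add: qp_def block_diff subspace_diff[OF subspace_block_space] block_in_block_space y)
    have R: "R i (dt $ i, block \<beta> (Inr i) db) + ereal (qr i) \<le> R i (et $ i, block \<beta> (Inr i) eb)" for i
      using r(2)[of "(et $ i, block \<beta> (Inr i) eb)" i]
      by (simp add: qr_def block_diff block_in_block_space)
    have "?u \<bullet> (x - ?z) = us \<bullet> (xs - zs) + ut \<bullet> (xt - zt) + ub \<bullet> (xb - zb)
        + (vs \<bullet> (es - ds) + vt \<bullet> (et - dt) + vb \<bullet> (eb - db))"
      by (simp add: x)
    moreover have "(vs \<bullet> (es - ds) + vt \<bullet> (et - dt) + vb \<bullet> (eb - db)) / c
        = (\<Sum>i\<in>UNIV. qp i) + (\<Sum>i\<in>UNIV. qr i)"
      unfolding qp_def qr_def inner_eq_sum_block[of vb "eb - db" \<beta>] sum_divide_distrib[symmetric]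
        sum.distrib inner_vec_def[of vs] inner_vec_def[of vt]
      by (simp add: add_divide_distrib)
    ultimately have "?u \<bullet> (x - ?z) / c = us \<bullet> (xs - zs) / c + ut \<bullet> (xt - zt) / c + ub \<bullet> (xb - zb) / c
        + ((\<Sum>i\<in>UNIV. qp i) + (\<Sum>i\<in>UNIV. qr i))"
      by (simp only: add_divide_distrib)
    then have "?F ?z + ereal (?u \<bullet> (x - ?z) / c) =
       (\<zeta> zs + ereal (us \<bullet> (xs - zs) / c)) + (\<omega> zt + ereal (ut \<bullet> (xt - zt) / c))
       + (\<theta> zb + ereal (ub \<bullet> (xb - zb) / c))
       + ((\<Sum>i\<in>UNIV. P i (ds $ i, block \<beta> (Inl i) db - y i) + ereal (qp i))
       + (\<Sum>i\<in>UNIV. R i (dt $ i, block \<beta> (Inr i) db) + ereal (qr i)))"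
      unfolding F by (simp only: plus_ereal.simps(1)[symmetric] sum.distrib sum_ereal ac_simps)
    also have "\<dots> \<le> ?F x"
      unfolding x F by (intro add_mono sum_mono s t b P R)
    finally show ?thesis .
  qed
  ultimately show ?thesis
    by (simp only: scaled_subdifferential_def mem_Collect_eq prod.case) blast
qed

lemma prox_perspective_subgradient:
  assumes "\<phi> \<in> Gamma0 (block_space \<beta> r)" "0 < c"
    and "p = prox (UNIV \<times> block_space \<beta> r) (\<lambda>u. ereal c * perspective (block_space \<beta> r) \<phi> u) z"
  shows "\<bar>perspective (block_space \<beta> r) \<phi> p\<bar> \<noteq> \<infinity>"
    and "\<And>x. x \<in> UNIV \<times> block_space \<beta> r \<Longrightarrow> perspective (block_space \<beta> r) \<phi> p
      + ereal ((z - p) \<bullet> (x - p) / c) \<le> perspective (block_space \<beta> r) \<phi> x"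
proof -
  have S: "subspace (UNIV \<times> block_space \<beta> r)"
    by (intro subspace_Times subspace_UNIV subspace_block_space)
  note * = prox_cmult_subgradient[OF perspective_Gamma0[OF assms(1) subspace_block_space]
      closed_subspace[OF S] subspace_imp_convex[OF S] assms(2,3)]
  show "\<bar>perspective (block_space \<beta> r) \<phi> p\<bar> \<noteq> \<infinity>" by (rule *)
  show "perspective (block_space \<beta> r) \<phi> p + ereal ((z - p) \<bullet> (x - p) / c)
      \<le> perspective (block_space \<beta> r) \<phi> x" if "x \<in> UNIV \<times> block_space \<beta> r" for x
    by (rule *(3)[OF that])
qed

section \<open>The algorithm as a Douglas--Rachford iteration\<close>

theorem mainTheorem5:
  fixes n :: nat and nn :: "'N::finite \<Rightarrow> nat" and pp :: "'P::finite \<Rightarrow> nat"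
    and \<beta> :: "'m::finite \<Rightarrow> 'N + 'P"
    and \<zeta> :: "real^'N \<Rightarrow> ereal" and \<omega> :: "real^'P \<Rightarrow> ereal" and \<theta> :: "real^'p::finite \<Rightarrow> ereal"
    and \<phi> :: "'N \<Rightarrow> real^'m \<Rightarrow> ereal" and X :: "'N \<Rightarrow> real^'p^'m" and y :: "'N \<Rightarrow> real^'m"
    and \<psi> :: "'P \<Rightarrow> real^'m \<Rightarrow> ereal" and L :: "'P \<Rightarrow> real^'p^'m"
    and A :: "real^'p^'m" and Q :: "real^'m^'p"
    and \<gamma> :: real and \<mu> :: "nat \<Rightarrow> real"
    and x_s h_s q_s s z_s d_s :: "nat \<Rightarrow> real^'N"
    and x_t h_t q_t t z_t d_t :: "nat \<Rightarrow> real^'P"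
    and x_b b z_b :: "nat \<Rightarrow> real^'p"
    and h_b q_b c_b d_b :: "nat \<Rightarrow> real^'m"
  assumes "\<And>i. 0 < nn i" and "\<And>i. card {j. \<beta> j = Inl i} = nn i" and "(\<Sum>i\<in>UNIV. nn i) = n"
    and "\<And>i. 0 < pp i" and "\<And>i. card {j. \<beta> j = Inr i} = pp i"
    and "\<zeta> \<in> Gamma0 UNIV" and "\<omega> \<in> Gamma0 UNIV" and "\<theta> \<in> Gamma0 UNIV"
    and "\<And>i. \<phi> i \<in> Gamma0 (block_space \<beta> (Inl i))"
    and "\<And>i. X i \<in> block_matrices \<beta> (Inl i)"
    and "\<And>i. y i \<in> block_space \<beta> (Inl i)"
    and "\<And>i. \<psi> i \<in> Gamma0 (block_space \<beta> (Inr i))"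
    and "\<And>i. L i \<in> block_matrices \<beta> (Inr i)"
    and "A = stack \<beta> X L"
    and "Q = transpose A ** matrix_inv (mat 1 + A ** transpose A)"
    and qualification:
      "bold_V (bold_L A)
       \<inter> rel_interior (dom_on UNIV (bold_F (bold_f \<zeta> \<omega> \<theta>) (bold_g \<beta> \<phi> y \<psi>))) \<noteq> {}"
    and solvable: "\<exists>u. solves \<beta> \<zeta> \<omega> \<theta> \<phi> X y \<psi> L u"
    and "0 < \<gamma>"
    and "\<And>k. 0 < \<mu> k \<and> \<mu> k < 2"
    and "filterlim (\<lambda>K. \<Sum>k<K. \<mu> k * (2 - \<mu> k)) at_top sequentially"
    and "\<And>k. q_s k = x_s k - h_s k"
    and "\<And>k. q_t k = x_t k - h_t k"
    and "\<And>k. q_b k = A *v x_b k - h_b k"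
    and "\<And>k. s k = x_s k - q_s k /\<^sub>R 2"
    and "\<And>k. t k = x_t k - q_t k /\<^sub>R 2"
    and "\<And>k. b k = x_b k - Q *v q_b k"
    and "\<And>k. z_s k = prox UNIV (\<lambda>u. ereal \<gamma> * \<zeta> u) (2 *\<^sub>R s k - x_s k)"
    and "\<And>k. z_t k = prox UNIV (\<lambda>u. ereal \<gamma> * \<omega> u) (2 *\<^sub>R t k - x_t k)"
    and "\<And>k. z_b k = prox UNIV (\<lambda>u. ereal \<gamma> * \<theta> u) (2 *\<^sub>R b k - x_b k)"
    and "\<And>k. x_s (Suc k) = x_s k + \<mu> k *\<^sub>R (z_s k - s k)"
    and "\<And>k. x_t (Suc k) = x_t k + \<mu> k *\<^sub>R (z_t k - t k)"
    and "\<And>k. x_b (Suc k) = x_b k + \<mu> k *\<^sub>R (z_b k - b k)"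
    and "\<And>k i. block \<beta> (Inl i) (c_b k) = X i *v b k"
    and "\<And>k i. (d_s k $ i, block \<beta> (Inl i) (d_b k)) =
           (0, y i) + prox (UNIV \<times> block_space \<beta> (Inl i))
             (\<lambda>u. ereal \<gamma> * perspective (block_space \<beta> (Inl i)) (\<phi> i) u)
             (2 * s k $ i - h_s k $ i,
              2 *\<^sub>R block \<beta> (Inl i) (c_b k) - block \<beta> (Inl i) (h_b k) - y i)"
    and "\<And>k i. block \<beta> (Inr i) (c_b k) = L i *v b k"
    and "\<And>k i. (d_t k $ i, block \<beta> (Inr i) (d_b k)) =
           prox (UNIV \<times> block_space \<beta> (Inr i))
             (\<lambda>u. ereal \<gamma> * perspective (block_space \<beta> (Inr i)) (\<psi> i) u)
             (2 * t k $ i - h_t k $ i,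
              2 *\<^sub>R block \<beta> (Inr i) (c_b k) - block \<beta> (Inr i) (h_b k))"
    and "\<And>k. h_s (Suc k) = h_s k + \<mu> k *\<^sub>R (d_s k - s k)"
    and "\<And>k. h_t (Suc k) = h_t k + \<mu> k *\<^sub>R (d_t k - t k)"
    and "\<And>k. h_b (Suc k) = h_b k + \<mu> k *\<^sub>R (d_b k - c_b k)"
  shows "\<exists>s' t' b'. s \<longlonglongrightarrow> s' \<and> t \<longlonglongrightarrow> t' \<and> b \<longlonglongrightarrow> b'
           \<and> solves \<beta> \<zeta> \<omega> \<theta> \<phi> X y \<psi> L (s', t', b')"
proof -
  note \<zeta> = assms(6) and \<omega> = assms(7) and \<theta> = assms(8) and \<phi> = assms(9)
    and X = assms(10) and y = assms(11) and \<psi> = assms(12) and L = assms(13)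
    and A = assms(14) and Q = assms(15) and \<gamma> = assms(18) and \<mu> = assms(19,20)
    and q = assms(21-23) and stb = assms(24-26) and z = assms(27-29) and xSuc = assms(30-32)
    and cN = assms(33) and dN = assms(34) and cP = assms(35) and dP = assms(36)
    and hSuc = assms(37-39)
  define F where "F = bold_F (bold_f \<zeta> \<omega> \<theta>) (bold_g \<beta> \<phi> y \<psi>)"
  let ?V = "bold_V (bold_L A) :: ((((real^'N) \<times> (real^'P)) \<times> (real^'p)) \<times> _) set"
  have block_A: "block \<beta> (Inl i) (A *v u) = X i *v u" "block \<beta> (Inr j) (A *v u) = L j *v u" for i j u
    unfolding A by (rule block_stack[OF X L])+
  have obj: "objective \<beta> \<zeta> \<omega> \<theta> \<phi> X y \<psi> L (s', t', b') = F (((s', t'), b'), ((s', t'), A *v b'))" for s' t' b'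
    by (simp add: objective_def F_def bold_F_def bold_f_def bold_g_def block_A add.assoc)
  \<comment> \<open>The subspace is parametrized by \<open>(s, t, b)\<close>, and the objective is
    \<open>F\<close> along this parametrization.\<close>
  have solves_iff: "solves \<beta> \<zeta> \<omega> \<theta> \<phi> X y \<psi> L (s', t', b') \<longleftrightarrow>
      (\<forall>v\<in>?V. F (((s', t'), b'), ((s', t'), A *v b')) \<le> F v)" for s' t' b'
  proof -
    have "(\<forall>v\<in>?V. G v) \<longleftrightarrow> (\<forall>s t b. G (((s, t), b), ((s, t), A *v b)))" for G
      by (auto simp: bold_V_def bold_L_def)
    then show ?thesis
      unfolding solves_def is_arg_min_def by (simp add: obj not_less)
  qed
  have F: "closed_convex_fun F"
    unfolding F_def by (rule closed_convex_fun_bold_F[OF \<zeta> \<omega> \<theta> \<phi> y \<psi>])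
  note V = subspace_bold_V[of A, where 'v = "(real^'N) \<times> (real^'P)"]
  \<comment> \<open>The iteration prescribes \<open>c_b k\<close> block by block; the blocks
    determine the vector.\<close>
  have c: "c_b k = A *v b k" for k
  proof (rule block_eqI)
    show "block \<beta> r (c_b k) = block \<beta> r (A *v b k)" for r
      by (cases r) (auto simp: block_A cN cP)
  qed
  define M where "M = scaled_subdifferential \<gamma> F"
  define w where "w k = (((x_s k, x_t k), x_b k), ((h_s k, h_t k), h_b k))" for k
  define p where "p k = (((s k, t k), b k), ((s k, t k), A *v b k))" for k
  define zz where "zz k = (((z_s k, z_t k), z_b k), ((d_s k, d_t k), d_b k))" for k
  have zero: "\<exists>x u. x \<in> ?V \<and> (\<forall>v\<in>?V. u \<bullet> v = 0) \<and> (x, u) \<in> M"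
  proof -
    obtain s' t' b' where sol: "solves \<beta> \<zeta> \<omega> \<theta> \<phi> X y \<psi> L (s', t', b')"
      using solvable by (metis surj_pair)
    define x where "x = (((s', t'), b'), ((s', t'), A *v b'))"
    have x: "x \<in> ?V" by (simp add: x_def bold_V_def bold_L_def)
    have min: "F x \<le> F v" if "v \<in> ?V" for v using sol that by (simp add: solves_iff x_def)
    obtain u where u: "\<bar>F x\<bar> \<noteq> \<infinity>" "\<And>v. v \<in> ?V \<Longrightarrow> u \<bullet> v = 0"
      "\<And>v. F x + ereal (u \<bullet> (v - x)) \<le> F v"
      using subgradient_orthogonal_to_subspace[OF _ _ V qualification[folded F_def] x min]
        F unfolding closed_convex_fun_def by metis
    \<comment> \<open>\<open>M\<close> is the subdifferential of \<open>\<gamma>\<close> times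
      \<open>F\<close>, hence the factor; orthogonality to the subspace is unaffected.\<close>
    have "(x, \<gamma> *\<^sub>R u) \<in> M" using u(1,3) \<gamma> by (simp add: M_def scaled_subdifferential_def)
    then show ?thesis using x u(2) by (intro exI[of _ x] exI[of _ "\<gamma> *\<^sub>R u"]) simp
  qed
  then obtain x0 u0 where "(x0, u0) \<in> M" by blast
  then have "\<bar>F x0\<bar> \<noteq> \<infinity>" by (simp add: M_def scaled_subdifferential_def)
  then have "x0 \<in> dom_on UNIV F" by (auto simp: dom_on_def)
  then have "dom_on UNIV F \<noteq> {}" by blast
  then have Mclosed: "closed M"
    unfolding M_def using F by (intro scaled_subdifferential_closed) (auto simp: closed_convex_fun_def)
  have pV: "p k \<in> ?V" for k by (simp add: p_def bold_V_def bold_L_def)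
  have perp: "(w k - p k) \<bullet> v = 0" if v: "v \<in> ?V" for k v
  proof -
    obtain s' t' b' where v: "v = (((s', t'), b'), ((s', t'), A *v b'))"
      using v by (cases v) (auto simp: bold_V_def bold_L_def)
    \<comment> \<open>For the components \<open>s\<close> and \<open>t\<close> the graph is a
      diagonal, and projection onto it is the midpoint of \<open>x\<close> and \<open>h\<close>,
      with opposite residuals.\<close>
    have mid: "(x - (x - (x - h) /\<^sub>R 2)) \<bullet> v + (h - (x - (x - h) /\<^sub>R 2)) \<bullet> v = 0"
      for x h v :: "'v::real_inner"
      by (simp add: inner_diff_left algebra_simps)
    show ?thesis
      using mid[of "x_s k" "h_s k" s'] mid[of "x_t k" "h_t k" t']
        graph_projection_orthogonal[OF Q stb(3)[of k, unfolded q(3)], of b']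
      by (simp add: w_def p_def v stb(1,2) q(1,2))
  qed
  have inM: "(zz k, 2 *\<^sub>R p k - w k - zz k) \<in> M" for k
  proof -
    have e: "2 *\<^sub>R p k - w k - zz k =
       (((2 *\<^sub>R s k - x_s k - z_s k, 2 *\<^sub>R t k - x_t k - z_t k), 2 *\<^sub>R b k - x_b k - z_b k),
        ((2 *\<^sub>R s k - h_s k - d_s k, 2 *\<^sub>R t k - h_t k - d_t k), 2 *\<^sub>R (A *v b k) - h_b k - d_b k))"
      by (simp add: p_def w_def zz_def)
    \<comment> \<open>Moving \<open>(0, y i)\<close> to the left leaves a plain prox in the shifted
      variable at which \<open>bold_g\<close> evaluates the perspective; the shift then cancels in
      the residual \<open>res\<close>.\<close>
    have dN': "(d_s k $ i, block \<beta> (Inl i) (d_b k) - y i) = prox (UNIV \<times> block_space \<beta> (Inl i))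
        (\<lambda>u. ereal \<gamma> * perspective (block_space \<beta> (Inl i)) (\<phi> i) u)
        (2 * s k $ i - h_s k $ i, 2 *\<^sub>R block \<beta> (Inl i) (c_b k) - block \<beta> (Inl i) (h_b k) - y i)" for i
      using dN[of k i] by (simp add: prod_eq_iff)
    have res: "(2 * s k $ i - h_s k $ i, 2 *\<^sub>R block \<beta> (Inl i) (c_b k) - block \<beta> (Inl i) (h_b k) - y i)
        - (d_s k $ i, block \<beta> (Inl i) (d_b k) - y i)
      = ((2 *\<^sub>R s k - h_s k - d_s k) $ i, block \<beta> (Inl i) (2 *\<^sub>R (A *v b k) - h_b k - d_b k))" for i
      by (simp add: c block_diff block_scale)
    show ?thesis
      unfolding e unfolding zz_def M_def F_def
    proof (rule bold_F_scaled_subdifferentialI[OF y])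
      show "\<bar>\<zeta> (z_s k)\<bar> \<noteq> \<infinity>" "\<zeta> (z_s k) + ereal ((2 *\<^sub>R s k - x_s k - z_s k) \<bullet> (x - z_s k) / \<gamma>) \<le> \<zeta> x" for x
        using prox_cmult_subgradient[OF \<zeta> _ _ \<gamma> z(1)] by auto
      show "\<bar>\<omega> (z_t k)\<bar> \<noteq> \<infinity>" "\<omega> (z_t k) + ereal ((2 *\<^sub>R t k - x_t k - z_t k) \<bullet> (x - z_t k) / \<gamma>) \<le> \<omega> x" for x
        using prox_cmult_subgradient[OF \<omega> _ _ \<gamma> z(2)] by auto
      show "\<bar>\<theta> (z_b k)\<bar> \<noteq> \<infinity>" "\<theta> (z_b k) + ereal ((2 *\<^sub>R b k - x_b k - z_b k) \<bullet> (x - z_b k) / \<gamma>) \<le> \<theta> x" for x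
        using prox_cmult_subgradient[OF \<theta> _ _ \<gamma> z(3)] by auto
      fix i x
      show "\<bar>perspective (block_space \<beta> (Inl i)) (\<phi> i) (d_s k $ i, block \<beta> (Inl i) (d_b k) - y i)\<bar> \<noteq> \<infinity>"
        by (rule prox_perspective_subgradient(1)[OF \<phi> \<gamma> dN'])
      show "perspective (block_space \<beta> (Inl i)) (\<phi> i) (d_s k $ i, block \<beta> (Inl i) (d_b k) - y i)
          + ereal (((2 *\<^sub>R s k - h_s k - d_s k) $ i, block \<beta> (Inl i) (2 *\<^sub>R (A *v b k) - h_b k - d_b k))
            \<bullet> (x - (d_s k $ i, block \<beta> (Inl i) (d_b k) - y i)) / \<gamma>)
          \<le> perspective (block_space \<beta> (Inl i)) (\<phi> i) x" if x: "x \<in> UNIV \<times> block_space \<beta> (Inl i)"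
        using prox_perspective_subgradient(2)[OF \<phi> \<gamma> dN' x] unfolding res .
    next
      fix i x
      show "\<bar>perspective (block_space \<beta> (Inr i)) (\<psi> i) (d_t k $ i, block \<beta> (Inr i) (d_b k))\<bar> \<noteq> \<infinity>"
        by (rule prox_perspective_subgradient(1)[OF \<psi> \<gamma> dP])
      show "perspective (block_space \<beta> (Inr i)) (\<psi> i) (d_t k $ i, block \<beta> (Inr i) (d_b k))
          + ereal (((2 *\<^sub>R t k - h_t k - d_t k) $ i, block \<beta> (Inr i) (2 *\<^sub>R (A *v b k) - h_b k - d_b k))
            \<bullet> (x - (d_t k $ i, block \<beta> (Inr i) (d_b k))) / \<gamma>)
          \<le> perspective (block_space \<beta> (Inr i)) (\<psi> i) x" if x: "x \<in> UNIV \<times> block_space \<beta> (Inr i)"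
        using prox_perspective_subgradient(2)[OF \<psi> \<gamma> dP x]
        by (simp add: c block_diff block_scale)
    qed
  qed
  have wSuc: "w (Suc k) = w k + \<mu> k *\<^sub>R (zz k - p k)" for k
    by (simp add: w_def zz_def p_def xSuc hSuc c)
  obtain x u where lim: "p \<longlonglongrightarrow> x" and x: "x \<in> ?V" and u: "\<And>v. v \<in> ?V \<Longrightarrow> u \<bullet> v = 0"
    and xu: "(x, u) \<in> M"
    using douglas_rachford_convergence[OF V scaled_subdifferential_monotone[OF \<gamma>, of _ _ F, folded M_def]
      Mclosed zero \<mu> pV perp inM wSuc] by blast
  obtain s' t' b' where x': "x = (((s', t'), b'), ((s', t'), A *v b'))"
    using x by (cases x) (auto simp: bold_V_def bold_L_def)
  \<comment> \<open>The subgradient is orthogonal to the subspace, so its linear term vanishes at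
    \<open>v - x\<close>.\<close>
  have "F x \<le> F v" if v: "v \<in> ?V" for v
  proof -
    have "F x + ereal (u \<bullet> (v - x) / \<gamma>) \<le> F v"
      using xu unfolding M_def scaled_subdifferential_def by blast
    then show ?thesis using u[OF subspace_diff[OF V v x]] by (simp flip: zero_ereal_def)
  qed
  then have "solves \<beta> \<zeta> \<omega> \<theta> \<phi> X y \<psi> L (s', t', b')" by (simp add: solves_iff x')
  moreover have "(\<lambda>k. fst (p k)) \<longlonglongrightarrow> ((s', t'), b')" using tendsto_fst[OF lim] by (simp add: x')
  then have "(\<lambda>k. ((s k, t k), b k)) \<longlonglongrightarrow> ((s', t'), b')" by (simp add: p_def)
  note tendsto_fst[OF tendsto_fst[OF this]] tendsto_snd[OF tendsto_fst[OF this]] tendsto_snd[OF this]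
  ultimately show ?thesis by auto
qed

end
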